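(* The sequence $\{T_n'^f:\mathrm{VTL}_n(R^f)\to R^f\}_{n=1}^\infty$ is a Markov trace (on the tower of algebras $\{\mathrm{VTL}_n(R^f)\}_{n=1}^\infty$ with respect to the homomorphisms $\rho_n^f$).
   Context: Let $R_0^f=\mathbb{Z}[z]$ and $R^f=\mathbb{Z}[A^{\pm1}]$, with $R_0^f$ embedded in $R^f$ via $z=-A^2-A^{-2}$. For $n\ge 1$, a flat virtual $n$-tangle is a partition of $V_n=\{0,1\}\times\{1,\dots,n\}$ into ($n$) pairs; $\mathcal{E}_n$ is the set of flat virtual $n$-tangles. $\mathrm{VTL}_n$ is the free $R_0^f$-module with basis $\mathcal{E}_n$, with the following bilinear multiplication. For $E,E'\in\mathcal{E}_n$, view the pairs as edges (arcs) and concatenate: take disjoint copies of the two and glue the point $(1,i)$ of $E$ to the point $(0,i)$ of $E'$ for each $i$. The result consists of $n$ arcs, whose endpoints are the points $(0,i)$ of $E$ and the points $(1,i)$ of $E'$, and some number $m$ of closed curves. The $n$ arcs determine a flat virtual $n$-tangle $E*E'$, and $E\,E'=z^m(E*E')$. This is an associative algebra with unit $\{\{(0,k),(1,k)\}\mid 1\le k\le n\}$. Set $\mathrm{VTL}_n(R^f)=R^f\otimes_{R_0^f}\mathrm{VTL}_n$. The map $E\mapsto E\cup\{\{(0,n+1),(1,n+1)\}\}$ induces an injective homomorphism $\mathrm{VTL}_n(R^f)\hookrightarrow\mathrm{VTL}_{n+1}(R^f)$, by which $\mathrm{VTL}_n(R^f)$ is viewed as a subalgebra of $\mathrm{VTL}_{n+1}(R^f)$.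 For $1\le i\le n-1$: $E_i=\{\{(0,i),(0,i+1)\},\{(1,i),(1,i+1)\}\}\cup\{\{(0,k),(1,k)\}\mid k\ne i,i+1\}$ and $v_i=\{\{(0,i),(1,i+1)\},\{(0,i+1),(1,i)\}\}\cup\{\{(0,k),(1,k)\}\mid k\neq i,i+1\}$. Set $S_i=-A^{-2}\,1-A^{-4}E_i$; it is invertible in $\mathrm{VTL}_n(R^f)$. (With $\mathrm{VB}_n$ the virtual braid group with its standard generators $\sigma_i,\tau_i$, the homomorphism $\rho_n^f:R^f[\mathrm{VB}_n]\to\mathrm{VTL}_n(R^f)$ sends $\sigma_i\mapsto S_i$, $\tau_i\mapsto v_i$.) For $E\in\mathcal{E}_n$, let $t_n(E)$ be the number of closed curves obtained from the arcs of $E$ by joining $(0,i)$ to $(1,i)$ by an additional arc for every $i\in\{1,\dots,n\}$. Set $T_n'^f(E)=z^{t_n(E)}=(-A^2-A^{-2})^{t_n(E)}$ and extend $R^f$-linearly to $T_n'^f:\mathrm{VTL}_n(R^f)\to R^f$. A sequence of $R^f$-linear forms $\{T_n':\mathrm{VTL}_n(R^f)\to R^f\}_{n=1}^\infty$ is a Markov trace if: (a) $T_n'(xy)=T_n'(yx)$ for all $n\ge1$ and all $x,y\in\mathrm{VTL}_n(R^f)$; (b) $T_n'(x)=T_{n+1}'(xS_n)=T_{n+1}'(xS_n^{-1})=T_{n+1}'(xv_n)$ for all $n\ge1$ and all $x\in\mathrm{VTL}_n(R^f)$; (c) $T_n'(x)=T_{n+1}'(xS_n^{-1}v_{n-1}S_n)$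 for all $n\ge2$ and all $x\in\mathrm{VTL}_n(R^f)$; (d) $T_n'(x)=T_{n+1}'(xv_nv_{n-1}S_{n-1}v_nS_{n-1}^{-1}v_{n-1}v_n)$ for all $n\ge2$ and all $x\in\mathrm{VTL}_n(R^f)$. *)

theory Defs
  imports "HOL-Library.Poly_Mapping" "HOL-Library.Disjoint_Sets"
    "HOL-Computational_Algebra.Polynomial" "HOL-Algebra.Module"
begin

subsection \<open>Coefficient rings\<close>

text \<open>
  The Laurent polynomial ring \<open>\<int>[A\<^sup>\<plusminus>\<^sup>1]\<close> is the group ring of the additive group of integers:
  finitely supported functions on exponents, multiplied by convolution.
\<close>

type_synonym laurent = "int \<Rightarrow>\<^sub>0 int"

definition Apow :: "int \<Rightarrow> laurent" where
  "Apow k = Poly_Mapping.single k 1"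

definition z_laurent :: laurent where
  "z_laurent = - Apow 2 - Apow (-2)"

definition embed_R0 :: "int poly \<Rightarrow> laurent" where
  "embed_R0 p = (\<Sum>i\<le>degree p. of_int (coeff p i) * z_laurent ^ i)"

subsection \<open>Flat virtual tangles\<close>

type_synonym point = "nat \<times> nat"
type_synonym tangle = "point set set"

definition tangle_points :: "nat \<Rightarrow> point set" where
  "tangle_points n = {0, 1} \<times> {1..n}"

definition flat_tangles :: "nat \<Rightarrow> tangle set" where
  "flat_tangles n = {E. partition_on (tangle_points n) E \<and> (\<forall>e\<in>E. card e = 2)}"

definition components :: "'a set \<Rightarrow> 'a set set \<Rightarrow> 'a set set" where
  "components V G = V // {(p, q). {p, q} \<in> G}\<^sup>*"

text \<open>
  Concatenation of \<open>E\<close> and \<open>E'\<close>: the second tangle is moved from levels 0, 1 to levels 1, 2, so that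
  its point \<open>(0, i)\<close> becomes the point \<open>(1, i)\<close> of the first.  A curve of the result is recorded as
  the set of points on it, that is, as a connected component; every edge has its end points among
  these points, so curves and components correspond bijectively (also when the same pair
  occurs in both tangles, where the two edges form one closed curve).
\<close>

definition glued_curves :: "nat \<Rightarrow> tangle \<Rightarrow> tangle \<Rightarrow> point set set" where
  "glued_curves n E E' =
     components ({0, 1, 2} \<times> {1..n}) (E \<union> (\<lambda>e. (\<lambda>(a, i). (a + 1, i)) ` e) ` E')"

definition outer_points :: "nat \<Rightarrow> point set" where
  "outer_points n = {0, 2} \<times> {1..n}"

definition closed_curves :: "nat \<Rightarrow> tangle \<Rightarrow> tangle \<Rightarrow> nat" where
  "closed_curves n E E' = card {C \<in> glued_curves n E E'. C \<inter> outer_points n = {}}"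

definition tangle_comp :: "nat \<Rightarrow> tangle \<Rightarrow> tangle \<Rightarrow> tangle" where
  "tangle_comp n E E' =
     {(\<lambda>(a, i). (if a = 0 then 0 else 1, i)) ` (C \<inter> outer_points n) | C.
        C \<in> glued_curves n E E' \<and> C \<inter> outer_points n \<noteq> {}}"

definition tangle_id :: "nat \<Rightarrow> tangle" where
  "tangle_id n = {{(0, k), (1, k)} | k. k \<in> {1..n}}"

definition tangle_E :: "nat \<Rightarrow> nat \<Rightarrow> tangle" where
  "tangle_E n i = {{(0, i), (0, i + 1)}, {(1, i), (1, i + 1)}} \<union>
     {{(0, k), (1, k)} | k. k \<in> {1..n} \<and> k \<noteq> i \<and> k \<noteq> i + 1}"

definition tangle_v :: "nat \<Rightarrow> nat \<Rightarrow> tangle" where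
  "tangle_v n i = {{(0, i), (1, i + 1)}, {(0, i + 1), (1, i)}} \<union>
     {{(0, k), (1, k)} | k. k \<in> {1..n} \<and> k \<noteq> i \<and> k \<noteq> i + 1}"

definition closure_curves :: "nat \<Rightarrow> tangle \<Rightarrow> nat" where
  "closure_curves n E =
     card (components (tangle_points n) (E \<union> {{(0, i), (1, i)} | i. i \<in> {1..n}}))"

subsection \<open>Virtual Temperley-Lieb algebras\<close>

definition vtl_mult ::
  "'r::comm_ring_1 \<Rightarrow> nat \<Rightarrow> (tangle \<Rightarrow>\<^sub>0 'r) \<Rightarrow> (tangle \<Rightarrow>\<^sub>0 'r) \<Rightarrow> (tangle \<Rightarrow>\<^sub>0 'r)" where
  "vtl_mult \<delta> n x y =
     (\<Sum>E\<in>Poly_Mapping.keys x. \<Sum>E'\<in>Poly_Mapping.keys y.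
        Poly_Mapping.single (tangle_comp n E E')
          (Poly_Mapping.lookup x E * Poly_Mapping.lookup y E' * \<delta> ^ closed_curves n E E'))"

definition VTL_alg :: "'r::comm_ring_1 \<Rightarrow> nat \<Rightarrow> ('r, tangle \<Rightarrow>\<^sub>0 'r) module" where
  "VTL_alg \<delta> n =
     \<lparr>carrier = {x. Poly_Mapping.keys x \<subseteq> flat_tangles n},
      mult = vtl_mult \<delta> n,
      one = Poly_Mapping.single (tangle_id n) 1,
      zero = 0,
      add = (+),
      smult = (\<lambda>c. Poly_Mapping.map ((*) c))\<rparr>"

definition VTL :: "nat \<Rightarrow> (int poly, tangle \<Rightarrow>\<^sub>0 int poly) module" where
  "VTL n = VTL_alg [:0, 1:] n"

text \<open>
  The base change along \<open>\<int>[z] \<rightarrow> \<int>[A\<^sup>\<plusminus>\<^sup>1]\<close> of the free module with basis \<open>flat_tangles n\<close> is the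
  free module on the same basis, with the structure constants \<open>z ^ m\<close> mapped to \<open>\<int>[A\<^sup>\<plusminus>\<^sup>1]\<close>.
  The lemma \<open>base_change_mult\<close> below states the compatibility with multiplication.
\<close>

definition VTL_R :: "nat \<Rightarrow> (laurent, tangle \<Rightarrow>\<^sub>0 laurent) module" where
  "VTL_R n = VTL_alg z_laurent n"

definition VTL_incl :: "nat \<Rightarrow> (tangle \<Rightarrow>\<^sub>0 laurent) \<Rightarrow> (tangle \<Rightarrow>\<^sub>0 laurent)" where
  "VTL_incl n x =
     (\<Sum>E\<in>Poly_Mapping.keys x.
        Poly_Mapping.single (E \<union> {{(0, n + 1), (1, n + 1)}}) (Poly_Mapping.lookup x E))"

definition v_gen :: "nat \<Rightarrow> nat \<Rightarrow> (tangle \<Rightarrow>\<^sub>0 laurent)" where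
  "v_gen n i = Poly_Mapping.single (tangle_v n i) 1"

definition E_gen :: "nat \<Rightarrow> nat \<Rightarrow> (tangle \<Rightarrow>\<^sub>0 laurent)" where
  "E_gen n i = Poly_Mapping.single (tangle_E n i) 1"

definition S_gen :: "nat \<Rightarrow> nat \<Rightarrow> (tangle \<Rightarrow>\<^sub>0 laurent)" where
  "S_gen n i =
     (- Apow (-2)) \<odot>\<^bsub>VTL_R n\<^esub> \<one>\<^bsub>VTL_R n\<^esub> \<oplus>\<^bsub>VTL_R n\<^esub> (- Apow (-4)) \<odot>\<^bsub>VTL_R n\<^esub> E_gen n i"

subsection \<open>Markov traces\<close>

definition linear_form :: "nat \<Rightarrow> ((tangle \<Rightarrow>\<^sub>0 laurent) \<Rightarrow> laurent) \<Rightarrow> bool" where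
  "linear_form n f \<longleftrightarrow>
     (\<forall>x\<in>carrier (VTL_R n). \<forall>y\<in>carrier (VTL_R n). f (x \<oplus>\<^bsub>VTL_R n\<^esub> y) = f x + f y) \<and>
     (\<forall>c. \<forall>x\<in>carrier (VTL_R n). f (c \<odot>\<^bsub>VTL_R n\<^esub> x) = c * f x)"

text \<open>
  In the stabilisation conditions all products and inverses are taken in \<open>VTL_R (n + 1)\<close>;
  the inclusion of \<open>VTL_R n\<close> is written explicitly.
\<close>

definition markov_trace :: "(nat \<Rightarrow> (tangle \<Rightarrow>\<^sub>0 laurent) \<Rightarrow> laurent) \<Rightarrow> bool" where
  "markov_trace T \<longleftrightarrow>
     (\<forall>n\<ge>1. linear_form n (T n)) \<and>
     (\<forall>n\<ge>1. \<forall>x\<in>carrier (VTL_R n). \<forall>y\<in>carrier (VTL_R n).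
        T n (x \<otimes>\<^bsub>VTL_R n\<^esub> y) = T n (y \<otimes>\<^bsub>VTL_R n\<^esub> x)) \<and>
     (\<forall>n\<ge>1. \<forall>x\<in>carrier (VTL_R n).
        T n x = T (n + 1) (VTL_incl n x \<otimes>\<^bsub>VTL_R (n + 1)\<^esub> S_gen (n + 1) n) \<and>
        T n x = T (n + 1) (VTL_incl n x \<otimes>\<^bsub>VTL_R (n + 1)\<^esub> inv\<^bsub>VTL_R (n + 1)\<^esub> S_gen (n + 1) n) \<and>
        T n x = T (n + 1) (VTL_incl n x \<otimes>\<^bsub>VTL_R (n + 1)\<^esub> v_gen (n + 1) n)) \<and>
     (\<forall>n\<ge>2. \<forall>x\<in>carrier (VTL_R n).
        T n x = T (n + 1)
          (VTL_incl n x
           \<otimes>\<^bsub>VTL_R (n + 1)\<^esub> inv\<^bsub>VTL_R (n + 1)\<^esub> S_gen (n + 1) n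
           \<otimes>\<^bsub>VTL_R (n + 1)\<^esub> v_gen (n + 1) (n - 1)
           \<otimes>\<^bsub>VTL_R (n + 1)\<^esub> S_gen (n + 1) n)) \<and>
     (\<forall>n\<ge>2. \<forall>x\<in>carrier (VTL_R n).
        T n x = T (n + 1)
          (VTL_incl n x
           \<otimes>\<^bsub>VTL_R (n + 1)\<^esub> v_gen (n + 1) n
           \<otimes>\<^bsub>VTL_R (n + 1)\<^esub> v_gen (n + 1) (n - 1)
           \<otimes>\<^bsub>VTL_R (n + 1)\<^esub> S_gen (n + 1) (n - 1)
           \<otimes>\<^bsub>VTL_R (n + 1)\<^esub> v_gen (n + 1) n
           \<otimes>\<^bsub>VTL_R (n + 1)\<^esub> inv\<^bsub>VTL_R (n + 1)\<^esub> S_gen (n + 1) (n - 1)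
           \<otimes>\<^bsub>VTL_R (n + 1)\<^esub> v_gen (n + 1) (n - 1)
           \<otimes>\<^bsub>VTL_R (n + 1)\<^esub> v_gen (n + 1) n))"

definition trace_f :: "nat \<Rightarrow> (tangle \<Rightarrow>\<^sub>0 laurent) \<Rightarrow> laurent" where
  "trace_f n x =
     (\<Sum>E\<in>Poly_Mapping.keys x. Poly_Mapping.lookup x E * z_laurent ^ closure_curves n E)"

subsection \<open>Compatibility with base change\<close>

lemma embed_R0_bound:
  assumes "degree p \<le> N"
  shows "embed_R0 p = (\<Sum>i\<le>N. of_int (coeff p i) * z_laurent ^ i)"
  unfolding embed_R0_def using assms
  by (intro sum.mono_neutral_left) (auto simp: coeff_eq_0 not_le)

lemma embed_R0_0: "embed_R0 0 = 0"
  and embed_R0_1: "embed_R0 1 = 1"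
  and embed_R0_z: "embed_R0 [:0, 1:] = z_laurent"
  by (simp_all add: embed_R0_def)

lemma embed_R0_add: "embed_R0 (p + q) = embed_R0 p + embed_R0 q"
proof -
  define N where "N = max (degree p) (degree q)"
  have "degree p \<le> N" "degree q \<le> N" "degree (p + q) \<le> N"
    by (auto simp: N_def intro: degree_add_le_max)
  then show ?thesis
    by (simp add: embed_R0_bound[of _ N] sum.distrib algebra_simps)
qed

lemma embed_R0_pCons: "embed_R0 (pCons a p) = of_int a + z_laurent * embed_R0 p"
proof -
  have "embed_R0 (pCons a p) =
      (\<Sum>i\<le>Suc (degree p). of_int (coeff (pCons a p) i) * z_laurent ^ i)"
    by (rule embed_R0_bound) (rule degree_pCons_le)
  also have "\<dots> = of_int a + z_laurent * embed_R0 p"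
    by (subst sum.atMost_Suc_shift) (simp add: embed_R0_def sum_distrib_left algebra_simps)
  finally show ?thesis .
qed

lemma embed_R0_mult: "embed_R0 (p * q) = embed_R0 p * embed_R0 q"
proof (induction p)
  case 0
  then show ?case by (simp add: embed_R0_0)
next
  case (pCons a p)
  have smult: "embed_R0 (Polynomial.smult a q) = of_int a * embed_R0 q"
    by (subst embed_R0_bound[OF degree_smult_le])
      (simp add: embed_R0_def sum_distrib_left mult.assoc)
  show ?case
    using pCons.IH
    by (simp add: embed_R0_add embed_R0_pCons smult algebra_simps)
qed

lemma embed_R0_power: "embed_R0 (p ^ m) = embed_R0 p ^ m"
  by (induction m) (simp_all add: embed_R0_1 embed_R0_mult)

definition base_change :: "(tangle \<Rightarrow>\<^sub>0 int poly) \<Rightarrow> (tangle \<Rightarrow>\<^sub>0 laurent)" where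
  "base_change = Poly_Mapping.map embed_R0"

lemma lookup_base_change:
  "Poly_Mapping.lookup (base_change x) E = embed_R0 (Poly_Mapping.lookup x E)"
  by (simp add: base_change_def Poly_Mapping.map.rep_eq embed_R0_0 when_def)

lemma base_change_single:
  "base_change (Poly_Mapping.single E c) = Poly_Mapping.single E (embed_R0 c)"
  by (rule poly_mapping_eqI) (simp add: lookup_base_change lookup_single embed_R0_0 when_def)

lemma base_change_add: "base_change (x + y) = base_change x + base_change y"
  by (rule poly_mapping_eqI) (simp add: lookup_base_change lookup_add embed_R0_add)

lemma base_change_sum: "base_change (sum f I) = (\<Sum>i\<in>I. base_change (f i))"
proof (induction I rule: infinite_finite_induct)
  case (infinite I)
  then show ?case
    by (simp add: poly_mapping_eqI lookup_base_change embed_R0_0)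
next
  case empty
  show ?case
    by (simp add: poly_mapping_eqI lookup_base_change embed_R0_0)
next
  case (insert i I)
  then show ?case by (simp add: base_change_add)
qed

lemma base_change_mult:
  "base_change (x \<otimes>\<^bsub>VTL n\<^esub> y) = base_change x \<otimes>\<^bsub>VTL_R n\<^esub> base_change y"
proof -
  have sub: "Poly_Mapping.keys (base_change w) \<subseteq> Poly_Mapping.keys w" for w
    by (auto simp: in_keys_iff lookup_base_change embed_R0_0)
  let ?t = "\<lambda>E E'. Poly_Mapping.single (tangle_comp n E E')
      (embed_R0 (Poly_Mapping.lookup x E) * embed_R0 (Poly_Mapping.lookup y E') *
       z_laurent ^ closed_curves n E E')"
  have "base_change (x \<otimes>\<^bsub>VTL n\<^esub> y) =
      (\<Sum>E\<in>Poly_Mapping.keys x. \<Sum>E'\<in>Poly_Mapping.keys y. ?t E E')"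
    by (simp add: VTL_def VTL_alg_def vtl_mult_def base_change_sum base_change_single
        embed_R0_mult embed_R0_power embed_R0_z)
  also have "\<dots> = (\<Sum>E\<in>Poly_Mapping.keys x. \<Sum>E'\<in>Poly_Mapping.keys (base_change y). ?t E E')"
    by (intro sum.cong refl sum.mono_neutral_right sub)
      (auto simp: in_keys_iff lookup_base_change)
  also have "\<dots> = (\<Sum>E\<in>Poly_Mapping.keys (base_change x).
      \<Sum>E'\<in>Poly_Mapping.keys (base_change y). ?t E E')"
    by (intro sum.mono_neutral_right sub)
      (auto simp: in_keys_iff lookup_base_change)
  also have "\<dots> = base_change x \<otimes>\<^bsub>VTL_R n\<^esub> base_change y"
    by (simp add: VTL_R_def VTL_alg_def vtl_mult_def lookup_base_change)
  finally show ?thesis .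
qed

end

theory Submission
  imports Defs
begin

text \<open>
  Colour the end points of a tangle with two colours and let its matrix record which colourings are
  constant on the arcs.  Gluing tangles multiplies these matrices, with a factor 2 for each closed
  curve, and the matrix trace of a tangle is 2 to the number of curves of its closure.  Since
  the matrix determines the tangle and a power of 2 its exponent, associativity, the trace property
  and all relations between the generators can be read off from \<open>0\<close>-\<open>1\<close>-matrices.

  In the algebra, \<open>S\<^sub>i\<close> has the inverse \<open>-A\<^sup>2 - A\<^sup>4 E\<^sub>i\<close>, and \<open>E\<^sub>n v\<^sub>n\<^sub>-\<^sub>1 E\<^sub>n = E\<^sub>n\<close> gives
  \<open>S\<^sub>n\<^sup>-\<^sup>1 v\<^sub>n\<^sub>-\<^sub>1 S\<^sub>n = v\<^sub>n\<^sub>-\<^sub>1 + A\<^sup>-\<^sup>2 v\<^sub>n\<^sub>-\<^sub>1 E\<^sub>n + A\<^sup>2 E\<^sub>n v\<^sub>n\<^sub>-\<^sub>1 + E\<^sub>n\<close>.  After multiplication by \<open>x\<close> the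
  first three terms have traces \<open>z q\<close>, \<open>A\<^sup>-\<^sup>2 q\<close>, \<open>A\<^sup>2 q\<close> for the same \<open>q\<close> and cancel, because
  \<open>z = -A\<^sup>2 - A\<^sup>-\<^sup>2\<close>.  The last condition reduces to the same cancellation after conjugation by
  \<open>v\<^sub>n v\<^sub>n\<^sub>-\<^sub>1\<close>.
\<close>

section \<open>Saturated sets and components\<close>

text \<open>The black class of a two-colouring of the points that is constant along every edge. Such
  sets are what the colouring matrices count.\<close>

definition saturated :: "'a set set \<Rightarrow> 'a set \<Rightarrow> bool" where
  "saturated G X \<longleftrightarrow> (\<forall>p q. {p, q} \<in> G \<longrightarrow> (p \<in> X \<longleftrightarrow> q \<in> X))"

lemma saturated_Un: "saturated (G \<union> H) X \<longleftrightarrow> saturated G X \<and> saturated H X"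
  by (auto simp: saturated_def)

lemma saturated_empty [simp]: "saturated G {}"
  by (simp add: saturated_def)

lemma saturated_insert: "saturated (insert {p, q} G) X \<longleftrightarrow> (p \<in> X \<longleftrightarrow> q \<in> X) \<and> saturated G X"
  by (auto simp: saturated_def doubleton_eq_iff)

lemma saturated_Collect:
  "saturated {{f k, g k} | k. P k} X \<longleftrightarrow> (\<forall>k. P k \<longrightarrow> (f k \<in> X \<longleftrightarrow> g k \<in> X))"
proof -
  have "saturated {{f k, g k} | k. P k} X" if "\<forall>k. P k \<longrightarrow> (f k \<in> X \<longleftrightarrow> g k \<in> X)"
    unfolding saturated_def using that by (auto simp: doubleton_eq_iff)
  moreover have "f k \<in> X \<longleftrightarrow> g k \<in> X" if "saturated {{f k, g k} | k. P k} X" "P k" for k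
    using that unfolding saturated_def by blast
  ultimately show ?thesis by blast
qed

text \<open>Points off \<open>V\<close> lie on no edge, so their membership cannot matter. This cuts
  colourings of a larger point set down to those of one tangle.\<close>

lemma saturated_Int_cong:
  assumes "\<Union>G \<subseteq> V" "X \<inter> V = Y \<inter> V"
  shows "saturated G X \<longleftrightarrow> saturated G Y"
proof -
  have "p \<in> X \<longleftrightarrow> p \<in> Y" if "{p, q} \<in> G" for p q
    using that assms by blast
  moreover have "q \<in> X \<longleftrightarrow> q \<in> Y" if "{p, q} \<in> G" for p q
    using that assms by blast
  ultimately show ?thesis unfolding saturated_def by metis
qed

lemma saturated_rtrancl:
  assumes "saturated G X" "(p, q) \<in> {(p, q). {p, q} \<in> G}\<^sup>*"
  shows "p \<in> X \<longleftrightarrow> q \<in> X"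
  using assms(2) by (induction) (use assms(1) in \<open>auto simp: saturated_def\<close>)

section \<open>Components as minimal saturated sets\<close>

lemma componentE:
  assumes "C \<in> components V G"
  obtains p where "p \<in> V" "C = {(p, q). {p, q} \<in> G}\<^sup>* `` {p}"
  using assms by (auto simp: components_def quotient_def)

lemma component_saturated:
  assumes "C \<in> components V G"
  shows "saturated G C"
proof -
  obtain p where p: "C = {(p, q). {p, q} \<in> G}\<^sup>* `` {p}"
    using assms by (rule componentE)
  have "r \<in> C" if "{q, r} \<in> G" "q \<in> C" for q r
    using that p by (auto intro: rtrancl_into_rtrancl)
  then show ?thesis
    unfolding saturated_def by (metis insert_commute)
qed

text \<open>Saturation propagates along paths. As components are saturated themselves, they are
  minimal among nonempty saturated sets; their disjointness follows from this alone.\<close>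

lemma component_subset_saturated:
  assumes "C \<in> components V G" "saturated G X" "C \<inter> X \<noteq> {}"
  shows "C \<subseteq> X"
proof -
  obtain p where p: "C = {(p, q). {p, q} \<in> G}\<^sup>* `` {p}"
    using assms(1) by (rule componentE)
  show ?thesis
    using assms(3) saturated_rtrancl[OF assms(2)] unfolding p by blast
qed

lemma edges_saturated: "\<Union>G \<subseteq> V \<Longrightarrow> saturated G V"
  unfolding saturated_def by blast

lemma component_nonempty: "C \<in> components V G \<Longrightarrow> C \<noteq> {}"
  by (erule componentE) auto

lemma component_subset:
  assumes "\<Union>G \<subseteq> V" "C \<in> components V G"
  shows "C \<subseteq> V"
proof -
  have "C \<inter> V \<noteq> {}" using assms(2) by (auto elim: componentE)
  then show ?thesis
    using component_subset_saturated[OF assms(2) edges_saturated[OF assms(1)]] by blast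
qed

lemma components_disjoint:
  assumes "C \<in> components V G" "D \<in> components V G" "C \<inter> D \<noteq> {}"
  shows "C = D"
  using component_subset_saturated[OF assms(1) component_saturated[OF assms(2)]]
    component_subset_saturated[OF assms(2) component_saturated[OF assms(1)]] assms(3) by blast

lemma components_cover:
  assumes "p \<in> V"
  shows "\<exists>C\<in>components V G. p \<in> C"
  using assms by (auto simp: components_def quotient_def)

lemma finite_components: "finite V \<Longrightarrow> finite (components V G)"
  by (simp add: components_def quotient_def)

section \<open>Counting saturated sets and edges of components\<close>

lemma saturated_Union: "(\<And>X. X \<in> \<X> \<Longrightarrow> saturated G X) \<Longrightarrow> saturated G (\<Union>\<X>)"
  unfolding saturated_def by blast

text \<open>A saturated subset of \<open>V\<close> is a union of components. The set
  \<open>B\<close> decides every component meeting \<open>W\<close>, while each component avoiding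
  \<open>W\<close> is a free binary choice; a component meeting both \<open>B\<close> and
  \<open>W - B\<close> rules out every extension. For a gluing with \<open>W\<close> the outer
  points, the free components are the closed curves.\<close>

lemma card_saturated_extensions:
  assumes V: "finite V" "\<Union>G \<subseteq> V" and B: "B \<subseteq> W" "W \<subseteq> V"
  shows "card {X. X \<subseteq> V \<and> X \<inter> W = B \<and> saturated G X} =
    (if \<forall>C\<in>components V G. C \<inter> W \<subseteq> B \<or> C \<inter> B = {}
     then 2 ^ card {C \<in> components V G. C \<inter> W = {}} else 0)"
proof (cases "\<forall>C\<in>components V G. C \<inter> W \<subseteq> B \<or> C \<inter> B = {}")
  case True
  let ?K = "components V G"
  let ?J = "{C \<in> ?K. C \<inter> W = {}}"
  let ?B = "{C \<in> ?K. C \<inter> B \<noteq> {}}"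
  \<comment> \<open>A family of components avoiding \<open>W\<close> is completed by the components
    meeting \<open>B\<close>, which are forced. The inverse map keeps those components inside
    \<open>X\<close> that avoid \<open>W\<close>.\<close>
  have "bij_betw (\<lambda>\<D>. \<Union>(\<D> \<union> ?B)) (Pow ?J) {X. X \<subseteq> V \<and> X \<inter> W = B \<and> saturated G X}"
  proof (rule bij_betw_byWitness[where f' = "\<lambda>X. {C \<in> ?J. C \<subseteq> X}"])
    show "\<forall>\<D>\<in>Pow ?J. {C \<in> ?J. C \<subseteq> \<Union>(\<D> \<union> ?B)} = \<D>"
    proof
      fix \<D> assume D: "\<D> \<in> Pow ?J"
      have "C \<in> \<D>" if C: "C \<in> ?J" "C \<subseteq> \<Union>(\<D> \<union> ?B)" for C
      proof -
        obtain p where "p \<in> C" using component_nonempty[of C V G] C by blast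
        with C(2) have "p \<in> \<Union>(\<D> \<union> ?B)" by (rule subsetD)
        then obtain D where D': "D \<in> \<D> \<union> ?B" "p \<in> D" by (rule UnionE)
        have "C \<in> ?K" "D \<in> ?K" "C \<inter> D \<noteq> {}" using C(1) D D' \<open>p \<in> C\<close> by auto
        then have "C = D" by (rule components_disjoint)
        moreover have "D \<notin> ?B" using C(1) B(1) \<open>C = D\<close> by blast
        ultimately show ?thesis using D'(1) by blast
      qed
      then show "{C \<in> ?J. C \<subseteq> \<Union>(\<D> \<union> ?B)} = \<D>" using D by blast
    qed
    show "\<forall>X\<in>{X. X \<subseteq> V \<and> X \<inter> W = B \<and> saturated G X}. \<Union>({C \<in> ?J. C \<subseteq> X} \<union> ?B) = X"
    proof
      fix X assume X: "X \<in> {X. X \<subseteq> V \<and> X \<inter> W = B \<and> saturated G X}"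
      have "C \<subseteq> X" if "C \<in> ?B" for C
        using that X component_subset_saturated[of C V G X] by blast
      moreover have "\<exists>C \<in> {C \<in> ?J. C \<subseteq> X} \<union> ?B. p \<in> C" if "p \<in> X" for p
      proof -
        obtain C where C: "C \<in> ?K" "p \<in> C" using components_cover[of p V G] X \<open>p \<in> X\<close> by blast
        then have "C \<subseteq> X" using component_subset_saturated[of C V G X] X \<open>p \<in> X\<close> by blast
        then show ?thesis using C X by blast
      qed
      ultimately show "\<Union>({C \<in> ?J. C \<subseteq> X} \<union> ?B) = X"
        by (intro subset_antisym Union_least subsetI) (auto simp only: Union_iff)
    qed
    show "(\<lambda>\<D>. \<Union>(\<D> \<union> ?B)) ` Pow ?J \<subseteq> {X. X \<subseteq> V \<and> X \<inter> W = B \<and> saturated G X}"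
    proof (rule image_subsetI, rule CollectI, intro conjI)
      fix \<D> assume D: "\<D> \<in> Pow ?J"
      have K: "\<D> \<union> ?B \<subseteq> ?K" using D by blast
      show "\<Union>(\<D> \<union> ?B) \<subseteq> V" using K component_subset[OF V(2)] by (intro Union_least) blast
      show "saturated G (\<Union>(\<D> \<union> ?B))"
        by (rule saturated_Union, rule component_saturated, rule subsetD[OF K])
      have "B \<subseteq> \<Union>?B" using components_cover[of _ V G] B by blast
      moreover have "C \<inter> W \<subseteq> B" if "C \<in> \<D> \<union> ?B" for C using that D True by auto
      ultimately show "\<Union>(\<D> \<union> ?B) \<inter> W = B" using B(1) by auto
    qed
    show "(\<lambda>X. {C \<in> ?J. C \<subseteq> X}) ` {X. X \<subseteq> V \<and> X \<inter> W = B \<and> saturated G X} \<subseteq> Pow ?J"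
      by blast
  qed
  from bij_betw_same_card[OF this] show ?thesis
    using True card_Pow[of ?J] finite_components[OF V(1)] by simp
next
  case False
  then have "{X. X \<subseteq> V \<and> X \<inter> W = B \<and> saturated G X} = {}"
    using component_subset_saturated[of _ V G] by blast
  then have "card {X. X \<subseteq> V \<and> X \<inter> W = B \<and> saturated G X} = 0" by (simp only: card.empty)
  with False show ?thesis by (simp only: if_False)
qed

text \<open>With \<open>W\<close> and \<open>B\<close> empty no component is constrained.\<close>

lemma card_saturated:
  assumes "finite V" "\<Union>G \<subseteq> V"
  shows "card {X. X \<subseteq> V \<and> saturated G X} = 2 ^ card (components V G)"
  using card_saturated_extensions[OF assms, of "{}" "{}"] by simp

text \<open>Grow a subset of \<open>C\<close> that satisfies the bound, starting from one point:
  each new neighbour brings at least one new edge, so a maximal such subset is saturated and is all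
  of \<open>C\<close>. This is the familiar lower bound on the number of edges of a connected
  graph.\<close>

lemma card_component_le:
  assumes "finite C" "finite G" "C \<in> components V G"
  shows "card C \<le> card {e \<in> G. e \<subseteq> C} + 1"
proof -
  obtain p where p: "C = {(p, q). {p, q} \<in> G}\<^sup>* `` {p}"
    using assms(3) by (rule componentE)
  define \<S> where "\<S> = {S. p \<in> S \<and> S \<subseteq> C \<and> card S \<le> card {e \<in> G. e \<subseteq> S} + 1}"
  have "{p} \<in> \<S>" by (auto simp: \<S>_def p)
  moreover have "finite \<S>"
    by (rule finite_subset[of _ "Pow C"]) (auto simp: \<S>_def assms(1))
  ultimately obtain S where S: "S \<in> \<S>" and max: "\<And>T. T \<in> \<S> \<Longrightarrow> S \<subseteq> T \<Longrightarrow> S = T"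
    using finite_has_maximal2[of \<S> "{p}"] by (metis)
  have "q \<in> S" if "{r, q} \<in> G" "r \<in> S" for r q
  proof (rule ccontr)
    assume "q \<notin> S"
    have fin: "finite S" using S assms(1) finite_subset unfolding \<S>_def by blast
    have "q \<in> C"
      using that S component_saturated[OF assms(3)] unfolding \<S>_def saturated_def by blast
    moreover have "card {e \<in> G. e \<subseteq> S} < card {e \<in> G. e \<subseteq> insert q S}"
    proof (rule psubset_card_mono)
      have "{r, q} \<in> {e \<in> G. e \<subseteq> insert q S} - {e \<in> G. e \<subseteq> S}"
        using that \<open>q \<notin> S\<close> by blast
      moreover have "{e \<in> G. e \<subseteq> S} \<subseteq> {e \<in> G. e \<subseteq> insert q S}" by auto
      ultimately show "{e \<in> G. e \<subseteq> S} \<subset> {e \<in> G. e \<subseteq> insert q S}" by (metis DiffE psubsetI)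
    qed (use assms(2) in simp)
    ultimately have "insert q S \<in> \<S>"
      using S fin \<open>q \<notin> S\<close> by (auto simp: \<S>_def)
    then show False using max[of "insert q S"] \<open>q \<notin> S\<close> by blast
  qed
  then have "saturated G S"
    unfolding saturated_def by (metis insert_commute)
  then have "C \<subseteq> S"
    using S component_subset_saturated[OF assms(3)] unfolding \<S>_def by blast
  then show ?thesis using S unfolding \<S>_def by auto
qed

section \<open>The colouring matrix of a tangle\<close>

lemma flat_tangle_partition:
  assumes "E \<in> flat_tangles n"
  shows "\<Union>E = tangle_points n" "\<And>e f. e \<in> E \<Longrightarrow> f \<in> E \<Longrightarrow> e \<inter> f \<noteq> {} \<Longrightarrow> e = f"
    "\<And>e. e \<in> E \<Longrightarrow> card e = 2"
  using assms unfolding flat_tangles_def partition_on_def disjoint_def by blast+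

lemma finite_tangle_points [simp]: "finite (tangle_points n)"
  by (simp add: tangle_points_def)

lemma finite_flat_tangle: "E \<in> flat_tangles n \<Longrightarrow> finite E"
  by (rule finite_UnionD) (simp add: flat_tangle_partition)

text \<open>\<open>saturated\<close> tests edges written as pairs; since every edge of a flat tangle
  has two points, this becomes a condition on whole edges.\<close>

lemma flat_tangle_saturated_iff:
  assumes "E \<in> flat_tangles n"
  shows "saturated E X \<longleftrightarrow> (\<forall>e\<in>E. e \<subseteq> X \<or> e \<inter> X = {})"
proof
  assume X: "saturated E X"
  show "\<forall>e\<in>E. e \<subseteq> X \<or> e \<inter> X = {}"
  proof
    fix e assume "e \<in> E"
    then obtain p q where "e = {p, q}"
      using flat_tangle_partition(3)[OF assms] by (metis card_2_iff)
    with X \<open>e \<in> E\<close> show "e \<subseteq> X \<or> e \<inter> X = {}" unfolding saturated_def by blast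
  qed
next
  assume X: "\<forall>e\<in>E. e \<subseteq> X \<or> e \<inter> X = {}"
  have "p \<in> X \<longleftrightarrow> q \<in> X" if "{p, q} \<in> E" for p q
    using bspec[OF X that] by auto
  then show "saturated E X" by (simp add: saturated_def)
qed

text \<open>The edges inside \<open>X\<close> are disjoint pairs, and by saturation they cover
  exactly the points of the tangle in \<open>X\<close>.\<close>

lemma flat_tangle_card_edges:
  assumes "E \<in> flat_tangles n" "saturated E X"
  shows "2 * card {e \<in> E. e \<subseteq> X} = card (X \<inter> tangle_points n)"
proof -
  have "\<Union>{e \<in> E. e \<subseteq> X} = X \<inter> tangle_points n"
    using assms(2) unfolding flat_tangle_saturated_iff[OF assms(1)]
      flat_tangle_partition(1)[OF assms(1), symmetric] by auto
  moreover have "2 * card {e \<in> E. e \<subseteq> X} = card (\<Union>{e \<in> E. e \<subseteq> X})"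
  proof (rule card_partition)
    show "finite (\<Union>{e \<in> E. e \<subseteq> X})" unfolding calculation by simp
    show "\<And>e f. e \<in> {e \<in> E. e \<subseteq> X} \<Longrightarrow> f \<in> {e \<in> E. e \<subseteq> X} \<Longrightarrow> e \<noteq> f \<Longrightarrow> e \<inter> f = {}"
      using flat_tangle_partition(2)[OF assms(1)] by blast
  qed (use finite_flat_tangle[OF assms(1)] flat_tangle_partition(3)[OF assms(1)] in auto)
  ultimately show ?thesis by simp
qed

text \<open>Injectivity recovers an edge from its image. This handles the second tangle of a gluing,
  whose edges are moved up one level.\<close>

lemma saturated_image:
  assumes "inj s"
  shows "saturated ((`) s ` G) X \<longleftrightarrow> saturated G (s -` X)"
proof
  assume X: "saturated ((`) s ` G) X"
  have "{s p, s q} \<in> (`) s ` G" if "{p, q} \<in> G" for p q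
    using imageI[OF that, of "(`) s"] by simp
  with X show "saturated G (s -` X)" by (auto simp: saturated_def)
next
  assume X: "saturated G (s -` X)"
  have "p \<in> X \<longleftrightarrow> q \<in> X" if pq: "{p, q} \<in> (`) s ` G" for p q
  proof -
    obtain e where e: "e \<in> G" "{p, q} = s ` e" using pq by blast
    then obtain p' q' where p': "p = s p'" "q = s q'" by blast
    with e have "s ` {p', q'} = s ` e" by simp
    then have "{p', q'} = e" by (simp only: inj_image_eq_iff[OF assms])
    with e X show ?thesis unfolding saturated_def p' by blast
  qed
  then show "saturated ((`) s ` G) X" unfolding saturated_def by blast
qed

section \<open>Gluing two tangles\<close>

abbreviation glued_points :: "nat \<Rightarrow> point set" where
  "glued_points n \<equiv> {0, 1, 2} \<times> {1..n}"

definition raise :: "point \<Rightarrow> point" where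
  "raise = (\<lambda>(a, i). (a + 1, i))"

text \<open>The relabelling inside \<open>tangle_comp\<close>. It merges levels 1 and 2, so it is
  injective on the outer points, which omit level 1, but not in general.\<close>

definition collapse :: "point \<Rightarrow> point" where
  "collapse = (\<lambda>(a, i). (if a = 0 then 0 else 1, i))"

lemma raise_simp [simp]: "raise (a, i) = (Suc a, i)"
  by (simp add: raise_def)

lemma collapse_simp [simp]: "collapse (a, i) = (if a = 0 then 0 else 1, i)"
  by (simp add: collapse_def)

lemma glued_curves_eq: "glued_curves n E F = components (glued_points n) (E \<union> (`) raise ` F)"
  by (simp add: glued_curves_def raise_def)

lemma tangle_comp_iff:
  "e \<in> tangle_comp n E F \<longleftrightarrow> (\<exists>C\<in>glued_curves n E F.
     C \<inter> outer_points n \<noteq> {} \<and> e = collapse ` (C \<inter> outer_points n))"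
  unfolding tangle_comp_def collapse_def by blast

lemma inj_raise: "inj raise"
  by (auto simp: inj_def)

lemma inj_collapse: "inj_on collapse (outer_points n)"
  by (auto simp: inj_on_def outer_points_def split: if_splits)

lemma collapse_outer_points: "collapse ` outer_points n = tangle_points n"
  by (force simp: outer_points_def tangle_points_def image_iff)

lemma glued_edges_subset:
  assumes "E \<in> flat_tangles n" "F \<in> flat_tangles n"
  shows "\<Union>(E \<union> (`) raise ` F) \<subseteq> glued_points n"
proof -
  have "\<Union>((`) raise ` F) = raise ` tangle_points n"
    using flat_tangle_partition(1)[OF assms(2)] by blast
  then show ?thesis
    using flat_tangle_partition(1)[OF assms(1)] by (auto simp: tangle_points_def)
qed

text \<open>Points on level 1 lie on two edges and outer points on one, so a component with \<open>c\<close> points,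
  \<open>d\<close> of them outer, has \<open>c - d / 2\<close> edges; connectedness requires at least \<open>c - 1\<close>.\<close>

lemma glued_curve_card_outer:
  assumes E: "E \<in> flat_tangles n" and F: "F \<in> flat_tangles n" and C: "C \<in> glued_curves n E F"
    and ne: "C \<inter> outer_points n \<noteq> {}"
  shows "card (C \<inter> outer_points n) = 2"
proof -
  let ?G = "E \<union> (`) raise ` F"
  have C': "C \<in> components (glued_points n) ?G" using C by (simp add: glued_curves_eq)
  have sub: "C \<subseteq> glued_points n"
    by (rule component_subset[OF glued_edges_subset[OF E F] C'])
  have fin: "finite C" by (rule finite_subset[OF sub]) simp
  have finE: "finite E" "finite F" using E F finite_flat_tangle by auto
  have sat: "saturated E C" "saturated F (raise -` C)"
    using component_saturated[OF C'] unfolding saturated_Un saturated_image[OF inj_raise] by blast+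
  define l where "l k = card (C \<inter> {k} \<times> {1..n})" for k :: nat
  have lE: "2 * card {e \<in> E. e \<subseteq> C} = l 0 + l 1"
  proof -
    have "C \<inter> tangle_points n = C \<inter> {0} \<times> {1..n} \<union> C \<inter> {1} \<times> {1..n}"
      by (auto simp: tangle_points_def)
    then show ?thesis unfolding flat_tangle_card_edges[OF E sat(1)] l_def
      using fin by (simp, subst card_Un_disjoint) auto
  qed
  have lF: "2 * card {f \<in> F. f \<subseteq> raise -` C} = l 1 + l 2"
  proof -
    have "card (raise -` C \<inter> tangle_points n) = card (raise ` (raise -` C \<inter> tangle_points n))"
      by (rule card_image[symmetric], rule inj_on_subset[OF inj_raise]) simp
    also have "raise ` (raise -` C \<inter> tangle_points n) = C \<inter> {1} \<times> {1..n} \<union> C \<inter> {2} \<times> {1..n}"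
    proof -
      have raise: "raise ` tangle_points n = {1, 2} \<times> {1..n}"
        by (force simp: tangle_points_def image_iff)
      have "raise ` (raise -` C \<inter> tangle_points n) = C \<inter> raise ` tangle_points n" by blast
      then show ?thesis unfolding raise by auto
    qed
    finally show ?thesis unfolding flat_tangle_card_edges[OF F sat(2)] l_def
      using fin by (simp, subst card_Un_disjoint) auto
  qed
  have lO: "card (C \<inter> outer_points n) = l 0 + l 2"
  proof -
    have "C \<inter> outer_points n = C \<inter> {0} \<times> {1..n} \<union> C \<inter> {2} \<times> {1..n}"
      by (auto simp: outer_points_def)
    then show ?thesis unfolding l_def
      using fin by (simp, subst card_Un_disjoint) auto
  qed
  have lC: "card C = l 0 + l 1 + l 2"
  proof -
    have "C = C \<inter> outer_points n \<union> C \<inter> {1} \<times> {1..n}"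
      using sub by (auto simp: outer_points_def)
    also have "card \<dots> = card (C \<inter> outer_points n) + l 1" unfolding l_def
      using fin by (subst card_Un_disjoint) (auto simp: outer_points_def)
    finally show ?thesis using lO by simp
  qed
  have "{e \<in> ?G. e \<subseteq> C} = {e \<in> E. e \<subseteq> C} \<union> (`) raise ` {f \<in> F. f \<subseteq> raise -` C}"
    by (auto simp: image_subset_iff_subset_vimage)
  \<comment> \<open>An inequality only: an arc between two points of level 1 may occur in both
    tangles and is then a single element of the union.\<close>
  then have "card {e \<in> ?G. e \<subseteq> C} \<le> card {e \<in> E. e \<subseteq> C} + card {f \<in> F. f \<subseteq> raise -` C}"
    using card_Un_le[of "{e \<in> E. e \<subseteq> C}" "(`) raise ` {f \<in> F. f \<subseteq> raise -` C}"]
      card_image_le[of "{f \<in> F. f \<subseteq> raise -` C}" "(`) raise"] finE by simp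
  moreover have "card C \<le> card {e \<in> ?G. e \<subseteq> C} + 1"
    by (rule card_component_le[OF fin _ C']) (use finE in simp)
  moreover have "card (C \<inter> outer_points n) \<noteq> 0" using ne fin by simp
  ultimately have "l 0 + l 1 + l 2 \<le> card {e \<in> E. e \<subseteq> C} + card {f \<in> F. f \<subseteq> raise -` C} + 1"
    "l 0 + l 2 \<noteq> 0"
    unfolding lC lO by simp_all
  \<comment> \<open>Doubling the inequality gives \<open>i + k \<le> 2\<close>. By the two equations
    \<open>i + k\<close> is even, and it is nonzero, so it is 2.\<close>
  moreover have "i + k = 2" if "2 * x = i + j" "2 * y = j + k" "i + j + k \<le> x + y + 1" "i + k \<noteq> 0"
    for x y i j k :: nat
    using that by presburger
  ultimately show ?thesis unfolding lO using lE lF by blast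
qed

text \<open>The curves partition the glued points, so those reaching the boundary partition the
  outer points, into blocks of size two by \<open>glued_curve_card_outer\<close>;
  \<open>collapse\<close> carries this over injectively.\<close>

lemma tangle_comp_closed:
  assumes E: "E \<in> flat_tangles n" and F: "F \<in> flat_tangles n"
  shows "tangle_comp n E F \<in> flat_tangles n"
proof -
  have ren: "collapse ` (C \<inter> outer_points n) \<inter> collapse ` (D \<inter> outer_points n)
      = collapse ` (C \<inter> D \<inter> outer_points n)" for C D
    using inj_on_image_Int[OF inj_collapse[of n], of "C \<inter> outer_points n" "D \<inter> outer_points n"]
    by (simp add: Int_ac)
  have "partition_on (tangle_points n) (tangle_comp n E F)"
  proof (rule partition_onI)
    have cover: "\<exists>C\<in>glued_curves n E F. q \<in> C" if "q \<in> outer_points n" for q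
      unfolding glued_curves_eq by (rule components_cover) (use that in \<open>auto simp: outer_points_def\<close>)
    show "\<Union>(tangle_comp n E F) = tangle_points n"
    proof
      show "\<Union>(tangle_comp n E F) \<subseteq> tangle_points n"
        unfolding collapse_outer_points[of n, symmetric]
        by (intro Union_least) (auto simp: tangle_comp_iff)
      show "tangle_points n \<subseteq> \<Union>(tangle_comp n E F)"
        unfolding collapse_outer_points[of n, symmetric]
      proof (rule image_subsetI)
        fix q assume q: "q \<in> outer_points n"
        obtain C where C: "C \<in> glued_curves n E F" "q \<in> C" using cover[OF q] by (rule bexE)
        then have "collapse ` (C \<inter> outer_points n) \<in> tangle_comp n E F"
          unfolding tangle_comp_iff using q by blast
        then show "collapse q \<in> \<Union>(tangle_comp n E F)" using q C(2) by (rule_tac UnionI) auto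
      qed
    qed
    show "{} \<notin> tangle_comp n E F" unfolding tangle_comp_iff by blast
    fix e f assume ef: "e \<in> tangle_comp n E F" "f \<in> tangle_comp n E F" "e \<noteq> f"
    then obtain C D where CD: "C \<in> glued_curves n E F" "D \<in> glued_curves n E F"
      "e = collapse ` (C \<inter> outer_points n)" "f = collapse ` (D \<inter> outer_points n)"
      unfolding tangle_comp_iff by blast
    with ef(3) have "C \<inter> D = {}"
      using components_disjoint[of C "glued_points n" _ D] unfolding glued_curves_eq by blast
    then show "disjnt e f" unfolding CD disjnt_def ren by simp
  qed
  moreover have "card e = 2" if e: "e \<in> tangle_comp n E F" for e
  proof -
    obtain C where C: "C \<in> glued_curves n E F" "C \<inter> outer_points n \<noteq> {}"
      "e = collapse ` (C \<inter> outer_points n)"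
      using e unfolding tangle_comp_iff by blast
    have "card e = card (C \<inter> outer_points n)"
      unfolding C(3) by (rule card_image, rule inj_on_subset[OF inj_collapse]) blast
    then show ?thesis using glued_curve_card_outer[OF E F C(1,2)] by simp
  qed
  ultimately show ?thesis by (simp add: flat_tangles_def)
qed

text \<open>The matrix of a tangle on two-colourings: the subset \<open>a\<close> is the set of points coloured
  black on level 0, \<open>b\<close> that on level 1.\<close>

definition tangle_mat :: "tangle \<Rightarrow> nat set \<Rightarrow> nat set \<Rightarrow> nat" where
  "tangle_mat E a b = of_bool (saturated E ({0} \<times> a \<union> {1} \<times> b))"

lemma sum_of_bool_card: "finite A \<Longrightarrow> (\<Sum>x\<in>A. of_bool (P x)) = card {x \<in> A. P x}"
  by (simp add: Int_def)

text \<open>A summand is 1 exactly when the colouring \<open>b\<close> of the middle level extends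
  the boundary colours \<open>a\<close> and \<open>c\<close> to a colouring constant along all
  edges. By \<open>card_saturated_extensions\<close> such extensions amount to a free choice on each
  closed curve, provided that every open arc has equal colours at its ends.\<close>

lemma tangle_mat_comp:
  assumes E: "E \<in> flat_tangles n" and F: "F \<in> flat_tangles n"
    and ac: "a \<subseteq> {1..n}" "c \<subseteq> {1..n}"
  shows "(\<Sum>b\<in>Pow {1..n}. tangle_mat E a b * tangle_mat F b c)
    = 2 ^ closed_curves n E F * tangle_mat (tangle_comp n E F) a c"
proof -
  let ?G = "E \<union> (`) raise ` F"
  let ?W = "outer_points n"
  define B :: "point set" where "B = {0} \<times> a \<union> {2} \<times> c"
  define Y :: "point set" where "Y = {0} \<times> a \<union> {1} \<times> c"
  have V: "finite (glued_points n)" "\<Union>?G \<subseteq> glued_points n" "B \<subseteq> ?W" "?W \<subseteq> glued_points n"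
    using glued_edges_subset[OF E F] ac by (auto simp: outer_points_def B_def)
  have split: "saturated ?G X \<longleftrightarrow> saturated E ({0} \<times> a \<union> {1} \<times> b) \<and> saturated F ({0} \<times> b \<union> {1} \<times> c)"
    if X: "X = B \<union> {1} \<times> b" for X b
  proof -
    have "saturated E X \<longleftrightarrow> saturated E ({0} \<times> a \<union> {1} \<times> b)"
    proof (rule saturated_Int_cong)
      show "\<Union>E \<subseteq> tangle_points n" by (simp add: flat_tangle_partition(1)[OF E])
      show "X \<inter> tangle_points n = ({0} \<times> a \<union> {1} \<times> b) \<inter> tangle_points n"
        by (auto simp: X B_def tangle_points_def)
    qed
    moreover have "raise -` X = {0} \<times> b \<union> {1} \<times> c" by (auto simp: X B_def)
    ultimately show ?thesis unfolding saturated_Un saturated_image[OF inj_raise] by (simp only:)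
  qed
  have "(\<Sum>b\<in>Pow {1..n}. tangle_mat E a b * tangle_mat F b c)
     = card {b \<in> Pow {1..n}. saturated E ({0} \<times> a \<union> {1} \<times> b) \<and> saturated F ({0} \<times> b \<union> {1} \<times> c)}"
    unfolding tangle_mat_def of_bool_conj[symmetric] by (rule sum_of_bool_card) simp
  also have "\<dots> = card {X. X \<subseteq> glued_points n \<and> X \<inter> ?W = B \<and> saturated ?G X}"
  proof (rule bij_betw_same_card, rule bij_betw_byWitness[where
        f = "\<lambda>b. B \<union> {1} \<times> b" and f' = "\<lambda>X. {i. (1, i) \<in> X}"])
    have X: "X = B \<union> {1} \<times> {i. (1, i) \<in> X}" if "X \<subseteq> glued_points n" "X \<inter> ?W = B" for X
      unfolding that(2)[symmetric] using that(1) by (auto simp: outer_points_def)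
    then show "\<forall>X\<in>{X. X \<subseteq> glued_points n \<and> X \<inter> ?W = B \<and> saturated ?G X}.
        B \<union> {1} \<times> {i. (1, i) \<in> X} = X" by blast
    show "(\<lambda>X. {i. (1, i) \<in> X}) ` {X. X \<subseteq> glued_points n \<and> X \<inter> ?W = B \<and> saturated ?G X}
      \<subseteq> {b \<in> Pow {1..n}. saturated E ({0} \<times> a \<union> {1} \<times> b) \<and> saturated F ({0} \<times> b \<union> {1} \<times> c)}"
    proof (rule image_subsetI)
      fix X assume "X \<in> {X. X \<subseteq> glued_points n \<and> X \<inter> ?W = B \<and> saturated ?G X}"
      then show "{i. (1, i) \<in> X} \<in> {b \<in> Pow {1..n}.
          saturated E ({0} \<times> a \<union> {1} \<times> b) \<and> saturated F ({0} \<times> b \<union> {1} \<times> c)}"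
        using split[OF X] by blast
    qed
    show "(\<lambda>b. B \<union> {1} \<times> b) ` {b \<in> Pow {1..n}. saturated E ({0} \<times> a \<union> {1} \<times> b) \<and>
        saturated F ({0} \<times> b \<union> {1} \<times> c)}
      \<subseteq> {X. X \<subseteq> glued_points n \<and> X \<inter> ?W = B \<and> saturated ?G X}"
      using split[OF refl] ac by (auto simp: B_def outer_points_def)
  qed (auto simp: B_def)
  also have "\<dots> = of_bool (\<forall>C\<in>glued_curves n E F. C \<inter> ?W \<subseteq> B \<or> C \<inter> B = {}) * 2 ^ closed_curves n E F"
    unfolding card_saturated_extensions[OF V] glued_curves_eq closed_curves_def by simp
  also have "(\<forall>C\<in>glued_curves n E F. C \<inter> ?W \<subseteq> B \<or> C \<inter> B = {})
      \<longleftrightarrow> saturated (tangle_comp n E F) Y"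
  proof -
    have B: "B = ?W \<inter> collapse -` Y"
      using ac by (auto simp: B_def Y_def outer_points_def split: if_splits)
    have "C \<inter> ?W \<subseteq> B \<or> C \<inter> B = {} \<longleftrightarrow>
        collapse ` (C \<inter> ?W) \<subseteq> Y \<or> collapse ` (C \<inter> ?W) \<inter> Y = {}" for C
      unfolding B by blast
    \<comment> \<open>Closed curves restrict to the empty set on the outer points and give no arc of
      the composite; the condition \<open>Q {}\<close> makes them harmless.\<close>
    moreover have "(\<forall>e\<in>tangle_comp n E F. Q e) \<longleftrightarrow> (\<forall>C\<in>glued_curves n E F. Q (collapse ` (C \<inter> ?W)))"
      if "Q {}" for Q
      unfolding Ball_def tangle_comp_iff using that by (metis image_empty)
    ultimately show ?thesis
      unfolding flat_tangle_saturated_iff[OF tangle_comp_closed[OF E F]] by simp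
  qed
  finally show ?thesis by (simp add: tangle_mat_def Y_def)
qed

text \<open>The closing arcs force equal colours on both levels, so the saturated sets of the
  closure correspond to the diagonal entries equal to 1, and \<open>card_saturated\<close> counts
  them.\<close>

lemma tangle_mat_trace:
  assumes E: "E \<in> flat_tangles n"
  shows "(\<Sum>a\<in>Pow {1..n}. tangle_mat E a a) = 2 ^ closure_curves n E"
proof -
  let ?I = "{{(0::nat, i), (1::nat, i)} | i. i \<in> {1..n}}"
  have sub: "\<Union>(E \<union> ?I) \<subseteq> tangle_points n"
    unfolding Union_Un_distrib flat_tangle_partition(1)[OF E] by (auto simp: tangle_points_def)
  have I: "saturated ?I X \<longleftrightarrow> (\<forall>i\<in>{1..n}. (0, i) \<in> X \<longleftrightarrow> (1, i) \<in> X)" for X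
    by (subst saturated_Collect) blast
  have "(\<Sum>a\<in>Pow {1..n}. tangle_mat E a a) = card {a \<in> Pow {1..n}. saturated E ({0} \<times> a \<union> {1} \<times> a)}"
    unfolding tangle_mat_def by (rule sum_of_bool_card) simp
  also have "\<dots> = card {X. X \<subseteq> tangle_points n \<and> saturated (E \<union> ?I) X}"
  proof (rule bij_betw_same_card, rule bij_betw_byWitness[where
        f = "\<lambda>a. {0} \<times> a \<union> {1} \<times> a" and f' = "\<lambda>X. {i. (0, i) \<in> X}"])
    have X: "{0} \<times> {i. (0, i) \<in> X} \<union> {1} \<times> {i. (0, i) \<in> X} = X"
      if "X \<subseteq> tangle_points n" "saturated ?I X" for X
      using that unfolding I by (auto simp: tangle_points_def)
    then show "\<forall>X\<in>{X. X \<subseteq> tangle_points n \<and> saturated (E \<union> ?I) X}.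
        {0} \<times> {i. (0, i) \<in> X} \<union> {1} \<times> {i. (0, i) \<in> X} = X"
      by (simp add: saturated_Un)
    show "(\<lambda>X. {i. (0, i) \<in> X}) ` {X. X \<subseteq> tangle_points n \<and> saturated (E \<union> ?I) X}
      \<subseteq> {a \<in> Pow {1..n}. saturated E ({0} \<times> a \<union> {1} \<times> a)}"
      using X by (auto simp: saturated_Un tangle_points_def)
    show "(\<lambda>a. {0} \<times> a \<union> {1} \<times> a) ` {a \<in> Pow {1..n}. saturated E ({0} \<times> a \<union> {1} \<times> a)}
      \<subseteq> {X. X \<subseteq> tangle_points n \<and> saturated (E \<union> ?I) X}"
      unfolding saturated_Un I by (auto simp: tangle_points_def)
  qed auto
  also have "\<dots> = 2 ^ closure_curves n E"
    unfolding closure_curves_def by (rule card_saturated[OF _ sub]) simp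
  finally show ?thesis .
qed

text \<open>The matrix records which subsets are saturated. An edge of one tangle is saturated
  there, hence in the other, so it contains every edge of the other that meets it; both have two
  points and therefore coincide.\<close>

lemma tangle_mat_inject:
  assumes E: "E \<in> flat_tangles n" and F: "F \<in> flat_tangles n"
    and eq: "\<And>a b. a \<subseteq> {1..n} \<Longrightarrow> b \<subseteq> {1..n} \<Longrightarrow> tangle_mat E a b = tangle_mat F a b"
  shows "E = F"
proof -
  have sat: "saturated E X \<longleftrightarrow> saturated F X" if X: "X \<subseteq> tangle_points n" for X
  proof -
    have "{0} \<times> {i. (0, i) \<in> X} \<union> {1} \<times> {i. (1, i) \<in> X} = X"
      "{i. (0, i) \<in> X} \<subseteq> {1..n}" "{i. (1, i) \<in> X} \<subseteq> {1..n}"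
      using X by (auto simp: tangle_points_def)
    with eq[of "{i. (0, i) \<in> X}" "{i. (1, i) \<in> X}"] show ?thesis
      unfolding tangle_mat_def by (metis of_bool_eq_iff)
  qed
  have "G \<subseteq> H" if G: "G \<in> flat_tangles n" and H: "H \<in> flat_tangles n"
    and sat: "\<And>X. X \<subseteq> tangle_points n \<Longrightarrow> saturated G X \<longleftrightarrow> saturated H X" for G H
  proof
    fix e assume e: "e \<in> G"
    then have ce: "card e = 2" "e \<noteq> {}" using flat_tangle_partition(3)[OF G] by fastforce+
    have "e \<subseteq> tangle_points n" using e flat_tangle_partition(1)[OF G] by blast
    then obtain p f where f: "p \<in> e" "f \<in> H" "p \<in> f"
      using ce(2) flat_tangle_partition(1)[OF H] by blast
    have "saturated H f"
      unfolding flat_tangle_saturated_iff[OF H] using flat_tangle_partition(2)[OF H] f(2) by blast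
    then have "saturated G f" using sat f(2) flat_tangle_partition(1)[OF H] by blast
    then have "e \<subseteq> f" unfolding flat_tangle_saturated_iff[OF G] using e f by blast
    moreover have "card f = 2" using f(2) flat_tangle_partition(3)[OF H] by blast
    ultimately have "e = f" using ce(1) by (metis card.infinite card_subset_eq zero_neq_numeral)
    then show "e \<in> H" using f by simp
  qed
  from this[OF E F] this[OF F E] sat show ?thesis by blast
qed

lemma tangle_mat_empty [simp]: "tangle_mat E {} {} = 1"
  by (simp add: tangle_mat_def)

text \<open>The entry at the empty colourings is 1 for every tangle, which isolates the powers of
  2.\<close>

lemma scaled_tangle_mat_inject:
  assumes E: "E \<in> flat_tangles n" and F: "F \<in> flat_tangles n"
    and eq: "\<And>a b. a \<subseteq> {1..n} \<Longrightarrow> b \<subseteq> {1..n} \<Longrightarrow>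
      2 ^ k * tangle_mat E a b = 2 ^ m * tangle_mat F a b"
  shows "E = F \<and> k = m"
proof -
  have "k = m" using eq[of "{}" "{}"] by simp
  moreover have "E = F"
    by (rule tangle_mat_inject[OF E F]) (use eq \<open>k = m\<close> in simp)
  ultimately show ?thesis by simp
qed

text \<open>Used to evaluate products of explicit tangles: once the composite and the exponent are
  guessed, one matrix identity confirms both.\<close>

lemma tangle_comp_eqI:
  assumes "E \<in> flat_tangles n" "F \<in> flat_tangles n" "G \<in> flat_tangles n"
    and "\<And>a c. a \<subseteq> {1..n} \<Longrightarrow> c \<subseteq> {1..n} \<Longrightarrow>
      (\<Sum>b\<in>Pow {1..n}. tangle_mat E a b * tangle_mat F b c) = 2 ^ m * tangle_mat G a c"
  shows "tangle_comp n E F = G \<and> closed_curves n E F = m"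
proof (rule scaled_tangle_mat_inject[OF tangle_comp_closed[OF assms(1,2)] assms(3)])
  fix a c assume ac: "a \<subseteq> {1..n}" "c \<subseteq> {1..n}"
  show "2 ^ closed_curves n E F * tangle_mat (tangle_comp n E F) a c = 2 ^ m * tangle_mat G a c"
    unfolding tangle_mat_comp[OF assms(1,2) ac, symmetric] by (rule assms(4)[OF ac])
qed

text \<open>Matrix multiplication is associative. The numbers of closed curves enter as exponents of
  2, so \<open>scaled_tangle_mat_inject\<close> compares them together with the tangles.\<close>

lemma tangle_comp_assoc:
  assumes E: "E \<in> flat_tangles n" and F: "F \<in> flat_tangles n" and G: "G \<in> flat_tangles n"
  shows "tangle_comp n (tangle_comp n E F) G = tangle_comp n E (tangle_comp n F G) \<and>
    closed_curves n E F + closed_curves n (tangle_comp n E F) G =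
    closed_curves n F G + closed_curves n E (tangle_comp n F G)"
proof (rule scaled_tangle_mat_inject)
  fix a d assume ad: "a \<subseteq> {1..n}" "d \<subseteq> {1..n}"
  let ?P = "Pow {1..n}"
  have "2 ^ (closed_curves n E F + closed_curves n (tangle_comp n E F) G) *
      tangle_mat (tangle_comp n (tangle_comp n E F) G) a d
    = (\<Sum>c\<in>?P. (\<Sum>b\<in>?P. tangle_mat E a b * tangle_mat F b c) * tangle_mat G c d)"
    unfolding power_add mult.assoc tangle_mat_comp[OF tangle_comp_closed[OF E F] G ad, symmetric]
      sum_distrib_left
    by (rule sum.cong) (use tangle_mat_comp[OF E F ad(1)] in \<open>simp_all add: sum_distrib_left\<close>)
  also have "\<dots> = (\<Sum>b\<in>?P. tangle_mat E a b * (\<Sum>c\<in>?P. tangle_mat F b c * tangle_mat G c d))"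
    unfolding sum_distrib_left sum_distrib_right by (subst sum.swap) (simp only: mult.assoc)
  also have "\<dots> = 2 ^ (closed_curves n F G + closed_curves n E (tangle_comp n F G)) *
      tangle_mat (tangle_comp n E (tangle_comp n F G)) a d"
    unfolding power_add mult.assoc tangle_mat_comp[OF E tangle_comp_closed[OF F G] ad, symmetric]
      sum_distrib_left[of "2 ^ closed_curves n F G"]
    by (rule sum.cong) (use tangle_mat_comp[OF F G _ ad(2)] in simp_all)
  finally show "2 ^ (closed_curves n E F + closed_curves n (tangle_comp n E F) G) *
      tangle_mat (tangle_comp n (tangle_comp n E F) G) a d =
    2 ^ (closed_curves n F G + closed_curves n E (tangle_comp n F G)) *
      tangle_mat (tangle_comp n E (tangle_comp n F G)) a d" .
qed (use assms in \<open>auto intro: tangle_comp_closed\<close>)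

text \<open>Both sides are the trace of the matrix product: curves closed by gluing and curves
  closed afterwards contribute to the same power of 2.\<close>

lemma closure_curves_comp:
  assumes E: "E \<in> flat_tangles n" and F: "F \<in> flat_tangles n"
  shows "2 ^ (closed_curves n E F + closure_curves n (tangle_comp n E F)) =
    (\<Sum>a\<in>Pow {1..n}. \<Sum>b\<in>Pow {1..n}. tangle_mat E a b * tangle_mat F b a)"
  unfolding power_add tangle_mat_trace[OF tangle_comp_closed[OF E F], symmetric] sum_distrib_left
  by (rule sum.cong) (use tangle_mat_comp[OF E F] in simp_all)

text \<open>The double sums are the traces of \<open>MN\<close> and \<open>NM\<close>, which differ
  only in the order of summation.\<close>

lemma closure_curves_comp_commute:
  assumes E: "E \<in> flat_tangles n" and F: "F \<in> flat_tangles n"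
  shows "closed_curves n E F + closure_curves n (tangle_comp n E F) =
    closed_curves n F E + closure_curves n (tangle_comp n F E)"
proof -
  have "(2::nat) ^ (closed_curves n E F + closure_curves n (tangle_comp n E F)) =
      2 ^ (closed_curves n F E + closure_curves n (tangle_comp n F E))"
    unfolding closure_curves_comp[OF E F] closure_curves_comp[OF F E]
    by (subst sum.swap) (simp only: mult.commute)
  then show ?thesis by (simp only: power_inject_exp one_less_numeral_iff semiring_norm)
qed

section \<open>Generators and stabilisation\<close>

text \<open>The image of \<open>a\<close> under the transposition of \<open>i\<close> and
  \<open>i + 1\<close>, written as a preimage; the two agree because the transposition is an
  involution.\<close>

definition swap_adj :: "nat \<Rightarrow> nat set \<Rightarrow> nat set" where
  "swap_adj i a = {k. (if k = i then i + 1 else if k = i + 1 then i else k) \<in> a}"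

definition tangle_incl :: "nat \<Rightarrow> tangle \<Rightarrow> tangle" where
  "tangle_incl n E = E \<union> {{(0, n + 1), (1, n + 1)}}"

lemma swap_adj_swap_adj [simp]: "swap_adj i (swap_adj i a) = a"
  by (auto simp: swap_adj_def)

lemma swap_adj_empty [simp]: "swap_adj i {} = {}"
  by (simp add: swap_adj_def)

lemma swap_adj_subset: "1 \<le> i \<Longrightarrow> i < n \<Longrightarrow> a \<subseteq> {1..n} \<Longrightarrow> swap_adj i a \<subseteq> {1..n}"
  by (auto simp: swap_adj_def split: if_splits)

section \<open>The generators as flat tangles\<close>

lemma flat_tanglesI:
  assumes "\<Union>E = tangle_points n" "\<And>e. e \<in> E \<Longrightarrow> card e = 2"
    "\<And>e f p. e \<in> E \<Longrightarrow> f \<in> E \<Longrightarrow> p \<in> e \<Longrightarrow> p \<in> f \<Longrightarrow> e = f"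
  shows "E \<in> flat_tangles n"
proof -
  have "disjnt e f" if "e \<in> E" "f \<in> E" "e \<noteq> f" for e f
    using assms(3)[OF that(1,2)] that(3) by (auto simp: disjnt_def)
  moreover have "{} \<notin> E" using assms(2)[of "{}"] by auto
  ultimately show ?thesis
    using assms(1,2) by (simp add: flat_tangles_def partition_onI)
qed

lemma Union_pairs: "\<Union>{{f k, g k} | k. P k} = f ` {k. P k} \<union> g ` {k. P k}"
  by blast

lemma tangle_id_flat: "tangle_id n \<in> flat_tangles n"
proof (rule flat_tanglesI)
  show "\<Union>(tangle_id n) = tangle_points n"
    unfolding tangle_id_def Union_pairs by (auto simp: tangle_points_def)
  show "\<And>e f p. e \<in> tangle_id n \<Longrightarrow> f \<in> tangle_id n \<Longrightarrow> p \<in> e \<Longrightarrow> p \<in> f \<Longrightarrow> e = f"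
    unfolding tangle_id_def by (elim CollectE exE conjE) auto
qed (auto simp: tangle_id_def card_insert_if)

lemma tangle_E_flat:
  assumes "1 \<le> i" "i < n"
  shows "tangle_E n i \<in> flat_tangles n"
proof (rule flat_tanglesI)
  show "\<Union>(tangle_E n i) = tangle_points n"
    unfolding tangle_E_def Union_Un_distrib Union_pairs
    using assms by (auto simp: tangle_points_def)
  show "\<And>e f p. e \<in> tangle_E n i \<Longrightarrow> f \<in> tangle_E n i \<Longrightarrow> p \<in> e \<Longrightarrow> p \<in> f \<Longrightarrow> e = f"
    unfolding tangle_E_def by (elim UnE insertE emptyE CollectE exE conjE) auto
qed (auto simp: tangle_E_def card_insert_if)

lemma tangle_v_flat:
  assumes "1 \<le> i" "i < n"
  shows "tangle_v n i \<in> flat_tangles n"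
proof (rule flat_tanglesI)
  show "\<Union>(tangle_v n i) = tangle_points n"
    unfolding tangle_v_def Union_Un_distrib Union_pairs
    using assms by (auto simp: tangle_points_def)
  show "\<And>e f p. e \<in> tangle_v n i \<Longrightarrow> f \<in> tangle_v n i \<Longrightarrow> p \<in> e \<Longrightarrow> p \<in> f \<Longrightarrow> e = f"
    unfolding tangle_v_def by (elim UnE insertE emptyE CollectE exE conjE) auto
qed (auto simp: tangle_v_def card_insert_if)

lemma tangle_incl_flat:
  assumes "E \<in> flat_tangles n"
  shows "tangle_incl n E \<in> flat_tangles (n + 1)"
proof (rule flat_tanglesI)
  let ?e = "{(0::nat, n + 1), (1::nat, n + 1)}"
  have new: "p \<notin> ?e" if "e \<in> E" "p \<in> e" for e p
  proof -
    have "p \<in> \<Union>E" using that by blast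
    then show ?thesis unfolding flat_tangle_partition(1)[OF assms] by (auto simp: tangle_points_def)
  qed
  show "\<Union>(tangle_incl n E) = tangle_points (n + 1)"
    unfolding tangle_incl_def Union_Un_distrib flat_tangle_partition(1)[OF assms]
    by (auto simp: tangle_points_def)
  show "card e = 2" if "e \<in> tangle_incl n E" for e
    using that flat_tangle_partition(3)[OF assms] by (auto simp: tangle_incl_def)
  show "e = f" if "e \<in> tangle_incl n E" "f \<in> tangle_incl n E" "p \<in> e" "p \<in> f" for e f p
    using that flat_tangle_partition(2)[OF assms, of e f] new[of e p] new[of f p]
    unfolding tangle_incl_def Un_iff singleton_iff by blast
qed

text \<open>For \<open>i < n\<close> the added strand is one of the straight strands of the larger
  tangle. This later makes \<open>v_{n-1}\<close> on \<open>n + 1\<close> strands an included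
  element.\<close>

lemma tangle_incl_v:
  assumes "i < n"
  shows "tangle_incl n (tangle_v n i) = tangle_v (n + 1) i"
proof -
  have "{{(0, k), (1, k)} | k. k \<in> {1..n + 1} \<and> k \<noteq> i \<and> k \<noteq> i + 1} =
      {{(0, k), (1, k)} | k. k \<in> {1..n} \<and> k \<noteq> i \<and> k \<noteq> i + 1} \<union> {{(0::nat, n + 1), (1::nat, n + 1)}}"
  proof -
    have "k \<in> {1..n + 1} \<and> k \<noteq> i \<and> k \<noteq> i + 1 \<longleftrightarrow>
        (k \<in> {1..n} \<and> k \<noteq> i \<and> k \<noteq> i + 1) \<or> k = n + 1" for k
      using assms by auto
    then show ?thesis by (simp only:) blast
  qed
  then show ?thesis unfolding tangle_incl_def tangle_v_def by (simp only: Un_assoc)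
qed

section \<open>Matrices of the generators\<close>

lemma tangle_mat_id:
  assumes "a \<subseteq> {1..n}" "b \<subseteq> {1..n}"
  shows "tangle_mat (tangle_id n) a b = of_bool (a = b)"
proof -
  have "saturated (tangle_id n) ({0} \<times> a \<union> {1} \<times> b) \<longleftrightarrow> a = b"
    unfolding tangle_id_def by (subst saturated_Collect) (use assms in auto)
  then show ?thesis by (simp add: tangle_mat_def)
qed

lemma tangle_mat_v:
  assumes "1 \<le> i" "i < n" "a \<subseteq> {1..n}" "b \<subseteq> {1..n}"
  shows "tangle_mat (tangle_v n i) a b = of_bool (a = swap_adj i b)"
proof -
  have "saturated (tangle_v n i) ({0} \<times> a \<union> {1} \<times> b) \<longleftrightarrow> (i \<in> a \<longleftrightarrow> i + 1 \<in> b) \<and> (i + 1 \<in> a \<longleftrightarrow> i \<in> b) \<and>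
      (\<forall>k. k \<in> {1..n} \<and> k \<noteq> i \<and> k \<noteq> i + 1 \<longrightarrow> (k \<in> a \<longleftrightarrow> k \<in> b))"
    unfolding tangle_v_def saturated_Un saturated_insert saturated_Collect
    by (simp add: saturated_def)
  also have "\<dots> \<longleftrightarrow> a = swap_adj i b"
    using assms unfolding swap_adj_def set_eq_iff by auto
  finally show ?thesis by (simp add: tangle_mat_def)
qed

lemma tangle_mat_E:
  assumes "1 \<le> i" "i < n" "a \<subseteq> {1..n}" "b \<subseteq> {1..n}"
  shows "tangle_mat (tangle_E n i) a b = of_bool ((i \<in> a \<longleftrightarrow> i + 1 \<in> a) \<and> (i \<in> b \<longleftrightarrow> i + 1 \<in> b) \<and>
    (\<forall>k. k \<noteq> i \<longrightarrow> k \<noteq> i + 1 \<longrightarrow> (k \<in> a \<longleftrightarrow> k \<in> b)))"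
proof -
  have "saturated (tangle_E n i) ({0} \<times> a \<union> {1} \<times> b) \<longleftrightarrow> (i \<in> a \<longleftrightarrow> i + 1 \<in> a) \<and> (i \<in> b \<longleftrightarrow> i + 1 \<in> b) \<and>
      (\<forall>k. k \<in> {1..n} \<and> k \<noteq> i \<and> k \<noteq> i + 1 \<longrightarrow> (k \<in> a \<longleftrightarrow> k \<in> b))"
    unfolding tangle_E_def saturated_Un saturated_insert saturated_Collect
    by (simp add: saturated_def)
  \<comment> \<open>Outside \<open>{1..n}\<close> neither \<open>a\<close> nor \<open>b\<close> has
    elements, so the range restriction can go.\<close>
  also have "(\<forall>k. k \<in> {1..n} \<and> k \<noteq> i \<and> k \<noteq> i + 1 \<longrightarrow> (k \<in> a \<longleftrightarrow> k \<in> b)) \<longleftrightarrow>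
      (\<forall>k. k \<noteq> i \<longrightarrow> k \<noteq> i + 1 \<longrightarrow> (k \<in> a \<longleftrightarrow> k \<in> b))"
    using assms by blast
  finally show ?thesis by (simp add: tangle_mat_def)
qed

text \<open>This is the tensor product with the 2 by 2 identity matrix: the added strand forces
  equal colours at \<open>n + 1\<close> and touches nothing else.\<close>

lemma tangle_mat_incl:
  assumes "E \<in> flat_tangles n"
  shows "tangle_mat (tangle_incl n E) a b =
    tangle_mat E (a - {n + 1}) (b - {n + 1}) * of_bool (n + 1 \<in> a \<longleftrightarrow> n + 1 \<in> b)"
proof -
  have "saturated E ({0} \<times> a \<union> {1} \<times> b) \<longleftrightarrow>
      saturated E ({0} \<times> (a - {n + 1}) \<union> {1} \<times> (b - {n + 1}))"
  proof (rule saturated_Int_cong)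
    show "\<Union>E \<subseteq> tangle_points n" by (simp add: flat_tangle_partition(1)[OF assms])
    show "({0} \<times> a \<union> {1} \<times> b) \<inter> tangle_points n =
        ({0} \<times> (a - {n + 1}) \<union> {1} \<times> (b - {n + 1})) \<inter> tangle_points n"
      by (auto simp: tangle_points_def)
  qed
  then show ?thesis
    by (simp add: tangle_mat_def tangle_incl_def saturated_insert)
qed

section \<open>Summation over middle colourings\<close>

lemma sum_of_bool_eq_left:
  fixes f :: "'a \<Rightarrow> nat"
  assumes "finite A" "x \<in> A" "\<And>y. y \<in> A \<Longrightarrow> P y \<longleftrightarrow> y = x"
  shows "(\<Sum>y\<in>A. of_bool (P y) * f y) = f x"
proof -
  have "(\<Sum>y\<in>A. of_bool (P y) * f y) = (\<Sum>y\<in>A. if y = x then f y else 0)"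
    by (rule sum.cong) (use assms(3) in auto)
  then show ?thesis using assms(1,2) by simp
qed

lemma sum_Pow_Suc:
  fixes f :: "nat set \<Rightarrow> nat"
  shows "(\<Sum>a\<in>Pow {1..n + 1}. f a) = (\<Sum>a\<in>Pow {1..n}. f a + f (insert (n + 1) a))"
proof -
  have "{1..n + 1} = insert (n + 1) {1..n}" by auto
  then have "(\<Sum>a\<in>Pow {1..n + 1}. f a) = (\<Sum>a\<in>Pow {1..n} \<union> insert (n + 1) ` Pow {1..n}. f a)"
    by (simp only: Pow_insert)
  also have "\<dots> = (\<Sum>a\<in>Pow {1..n}. f a) + (\<Sum>a\<in>insert (n + 1) ` Pow {1..n}. f a)"
    by (rule sum.union_disjoint) auto
  also have "(\<Sum>a\<in>insert (n + 1) ` Pow {1..n}. f a) = (\<Sum>a\<in>Pow {1..n}. f (insert (n + 1) a))"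
  proof (rule sum.reindex_cong)
    show "inj_on (insert (n + 1)) (Pow {1..n})"
      by (rule inj_on_inverseI[where g = "\<lambda>a. a - {n + 1}"]) auto
  qed auto
  finally show ?thesis by (simp add: sum.distrib)
qed

text \<open>When nonzero, row \<open>a\<close> of the matrix has exactly two ones: \<open>i\<close>
  and \<open>i + 1\<close> receive a common colour, white or black, and the other points keep
  theirs.\<close>

lemma sum_tangle_mat_E:
  assumes i: "1 \<le> i" "i < n" and a: "a \<subseteq> {1..n}"
  shows "(\<Sum>b\<in>Pow {1..n}. tangle_mat (tangle_E n i) a b * f b) =
    of_bool (i \<in> a \<longleftrightarrow> i + 1 \<in> a) * (f (a - {i, i + 1}) + f (a \<union> {i, i + 1}))"
proof (cases "i \<in> a \<longleftrightarrow> i + 1 \<in> a")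
  case True
  let ?l = "a - {i, i + 1}" and ?u = "a \<union> {i, i + 1}"
  have lu: "?l \<in> Pow {1..n}" "?u \<in> Pow {1..n}" "?l \<noteq> ?u" using i a by auto
  have "(\<Sum>b\<in>Pow {1..n}. tangle_mat (tangle_E n i) a b * f b) =
      (\<Sum>b\<in>{?l, ?u}. tangle_mat (tangle_E n i) a b * f b)"
  proof (rule sum.mono_neutral_right)
    show "\<forall>b\<in>Pow {1..n} - {?l, ?u}. tangle_mat (tangle_E n i) a b * f b = 0"
    proof
      fix b assume b: "b \<in> Pow {1..n} - {?l, ?u}"
      then have "b \<noteq> ?l" "b \<noteq> ?u" by auto
      then have "\<not> ((i \<in> b \<longleftrightarrow> i + 1 \<in> b) \<and> (\<forall>k. k \<noteq> i \<longrightarrow> k \<noteq> i + 1 \<longrightarrow> (k \<in> a \<longleftrightarrow> k \<in> b)))"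
        unfolding set_eq_iff by auto
      then show "tangle_mat (tangle_E n i) a b * f b = 0"
        using tangle_mat_E[OF i a] b by auto
    qed
  qed (use lu in auto)
  moreover have "tangle_mat (tangle_E n i) a ?l = 1" "tangle_mat (tangle_E n i) a ?u = 1"
    using tangle_mat_E[OF i a] lu True by auto
  ultimately show ?thesis using lu True by simp
next
  case False
  then show ?thesis using tangle_mat_E[OF i a] by (auto intro!: sum.neutral)
qed

section \<open>Products with the identity and with \<open>v_i\<close>\<close>

lemma tangle_comp_id_left:
  assumes "E \<in> flat_tangles n"
  shows "tangle_comp n (tangle_id n) E = E \<and> closed_curves n (tangle_id n) E = 0"
proof (rule tangle_comp_eqI[OF tangle_id_flat assms assms])
  fix a c assume ac: "a \<subseteq> {1..n}" "c \<subseteq> {1..n}"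
  have "(\<Sum>b\<in>Pow {1..n}. tangle_mat (tangle_id n) a b * tangle_mat E b c) =
      (\<Sum>b\<in>Pow {1..n}. of_bool (a = b) * tangle_mat E b c)"
    by (rule sum.cong) (use tangle_mat_id[OF ac(1)] in auto)
  also have "\<dots> = tangle_mat E a c" by (rule sum_of_bool_eq_left) (use ac in auto)
  finally show "(\<Sum>b\<in>Pow {1..n}. tangle_mat (tangle_id n) a b * tangle_mat E b c) =
      2 ^ 0 * tangle_mat E a c" by simp
qed

lemma tangle_comp_id_right:
  assumes "E \<in> flat_tangles n"
  shows "tangle_comp n E (tangle_id n) = E \<and> closed_curves n E (tangle_id n) = 0"
proof (rule tangle_comp_eqI[OF assms tangle_id_flat assms])
  fix a c assume ac: "a \<subseteq> {1..n}" "c \<subseteq> {1..n}"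
  have "(\<Sum>b\<in>Pow {1..n}. tangle_mat E a b * tangle_mat (tangle_id n) b c) =
      (\<Sum>b\<in>Pow {1..n}. of_bool (b = c) * tangle_mat E a b)"
    by (rule sum.cong) (use tangle_mat_id[OF _ ac(2)] in auto)
  also have "\<dots> = tangle_mat E a c" by (rule sum_of_bool_eq_left) (use ac in auto)
  finally show "(\<Sum>b\<in>Pow {1..n}. tangle_mat E a b * tangle_mat (tangle_id n) b c) =
      2 ^ 0 * tangle_mat E a c" by simp
qed

lemma sum_tangle_mat_v_left:
  assumes i: "1 \<le> i" "i < n" and a: "a \<subseteq> {1..n}"
  shows "(\<Sum>b\<in>Pow {1..n}. tangle_mat (tangle_v n i) a b * f b) = f (swap_adj i a)"
proof -
  have "(\<Sum>b\<in>Pow {1..n}. tangle_mat (tangle_v n i) a b * f b) =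
      (\<Sum>b\<in>Pow {1..n}. of_bool (a = swap_adj i b) * f b)"
    by (rule sum.cong) (use tangle_mat_v[OF i a] in auto)
  also have "\<dots> = f (swap_adj i a)"
    by (rule sum_of_bool_eq_left) (use swap_adj_subset[OF i a] in auto)
  finally show ?thesis .
qed

lemma sum_tangle_mat_v_right:
  assumes i: "1 \<le> i" "i < n" and c: "c \<subseteq> {1..n}"
  shows "(\<Sum>b\<in>Pow {1..n}. f b * tangle_mat (tangle_v n i) b c) = f (swap_adj i c)"
proof -
  have "(\<Sum>b\<in>Pow {1..n}. f b * tangle_mat (tangle_v n i) b c) =
      (\<Sum>b\<in>Pow {1..n}. of_bool (b = swap_adj i c) * f b)"
    by (rule sum.cong) (use tangle_mat_v[OF i _ c] in auto)
  also have "\<dots> = f (swap_adj i c)"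
    by (rule sum_of_bool_eq_left) (use swap_adj_subset[OF i c] in auto)
  finally show ?thesis .
qed

text \<open>The matrix of \<open>v_i\<close> is a permutation matrix, so at the empty colourings the
  matrix product is the single entry 1; \<open>tangle_mat_comp\<close> equates it with the power of
  2.\<close>

lemma closed_curves_v_left:
  assumes i: "1 \<le> i" "i < n" and E: "E \<in> flat_tangles n"
  shows "closed_curves n (tangle_v n i) E = 0"
  using tangle_mat_comp[OF tangle_v_flat[OF i] E, of "{}" "{}"] sum_tangle_mat_v_left[OF i, of "{}"]
  by (simp del: One_nat_def)

lemma closed_curves_v_right:
  assumes i: "1 \<le> i" "i < n" and E: "E \<in> flat_tangles n"
  shows "closed_curves n E (tangle_v n i) = 0"
  using tangle_mat_comp[OF E tangle_v_flat[OF i], of "{}" "{}"] sum_tangle_mat_v_right[OF i, of "{}"]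
  by (simp del: One_nat_def)

lemma tangle_mat_v_comp:
  assumes i: "1 \<le> i" "i < n" and E: "E \<in> flat_tangles n" and ac: "a \<subseteq> {1..n}" "c \<subseteq> {1..n}"
  shows "tangle_mat (tangle_comp n (tangle_v n i) E) a c = tangle_mat E (swap_adj i a) c"
  using tangle_mat_comp[OF tangle_v_flat[OF i] E ac] sum_tangle_mat_v_left[OF i ac(1)]
    closed_curves_v_left[OF i E] by simp

lemma tangle_mat_comp_v:
  assumes i: "1 \<le> i" "i < n" and E: "E \<in> flat_tangles n" and ac: "a \<subseteq> {1..n}" "c \<subseteq> {1..n}"
  shows "tangle_mat (tangle_comp n E (tangle_v n i)) a c = tangle_mat E a (swap_adj i c)"
  using tangle_mat_comp[OF E tangle_v_flat[OF i] ac] sum_tangle_mat_v_right[OF i ac(2)]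
    closed_curves_v_right[OF i E] by simp

text \<open>Both middle colourings of the row sum contribute equally, whence the factor 2 and one
  closed curve.\<close>

lemma tangle_comp_E_E:
  assumes i: "1 \<le> i" "i < n"
  shows "tangle_comp n (tangle_E n i) (tangle_E n i) = tangle_E n i \<and>
    closed_curves n (tangle_E n i) (tangle_E n i) = 1"
proof (rule tangle_comp_eqI[OF tangle_E_flat[OF i] tangle_E_flat[OF i] tangle_E_flat[OF i]])
  fix a c assume ac: "a \<subseteq> {1..n}" "c \<subseteq> {1..n}"
  have lu: "a - {i, i + 1} \<subseteq> {1..n}" "a \<union> {i, i + 1} \<subseteq> {1..n}" using ac i by auto
  show "(\<Sum>b\<in>Pow {1..n}. tangle_mat (tangle_E n i) a b * tangle_mat (tangle_E n i) b c) =
      2 ^ 1 * tangle_mat (tangle_E n i) a c"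
    unfolding sum_tangle_mat_E[OF i ac(1)] tangle_mat_E[OF i ac] tangle_mat_E[OF i lu(1) ac(2)]
      tangle_mat_E[OF i lu(2) ac(2)]
    by auto
qed

text \<open>With memberships of \<open>i\<close>, \<open>i + 1\<close>, \<open>i + 2\<close> split off from the remaining ones, relations between
  the generators at \<open>i\<close> and \<open>i + 1\<close> become propositional tautologies.\<close>

definition agree_off :: "nat \<Rightarrow> nat set \<Rightarrow> nat set \<Rightarrow> bool" where
  "agree_off i a b \<longleftrightarrow> (\<forall>k. k \<noteq> i \<longrightarrow> k \<noteq> Suc i \<longrightarrow> k \<noteq> Suc (Suc i) \<longrightarrow> (k \<in> a \<longleftrightarrow> k \<in> b))"

lemma agree_off_simps [simp]:
  "agree_off i (swap_adj i a) b = agree_off i a b" "agree_off i a (swap_adj i b) = agree_off i a b"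
  "agree_off i (swap_adj (Suc i) a) b = agree_off i a b"
  "agree_off i a (swap_adj (Suc i) b) = agree_off i a b"
  "agree_off i (a - {i, Suc i}) b = agree_off i a b"
  "agree_off i (insert i (insert (Suc i) a)) b = agree_off i a b"
  "agree_off i (a - {Suc i, Suc (Suc i)}) b = agree_off i a b"
  "agree_off i (insert (Suc i) (insert (Suc (Suc i)) a)) b = agree_off i a b"
  by (auto simp: agree_off_def swap_adj_def)

lemma swap_adj_mem [simp]:
  "i \<in> swap_adj i a \<longleftrightarrow> Suc i \<in> a" "Suc i \<in> swap_adj i a \<longleftrightarrow> i \<in> a"
  "Suc (Suc i) \<in> swap_adj i a \<longleftrightarrow> Suc (Suc i) \<in> a"
  "i \<in> swap_adj (Suc i) a \<longleftrightarrow> i \<in> a"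
  by (auto simp: swap_adj_def)

lemma split_three:
  "(\<forall>k. P k) \<longleftrightarrow> P i \<and> P (Suc i) \<and> P (Suc (Suc i)) \<and>
    (\<forall>k. k \<noteq> i \<longrightarrow> k \<noteq> Suc i \<longrightarrow> k \<noteq> Suc (Suc i) \<longrightarrow> P k)"
  by metis

lemma set_eq_agree_off:
  "a = b \<longleftrightarrow> (i \<in> a \<longleftrightarrow> i \<in> b) \<and> (Suc i \<in> a \<longleftrightarrow> Suc i \<in> b) \<and> (Suc (Suc i) \<in> a \<longleftrightarrow> Suc (Suc i) \<in> b) \<and>
    agree_off i a b"
  unfolding set_eq_iff agree_off_def by (rule split_three)

lemma tangle_mat_E_fst:
  assumes "1 \<le> i" "i < n" "a \<subseteq> {1..n}" "b \<subseteq> {1..n}"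
  shows "tangle_mat (tangle_E n i) a b = of_bool ((i \<in> a \<longleftrightarrow> Suc i \<in> a) \<and> (i \<in> b \<longleftrightarrow> Suc i \<in> b) \<and>
    (Suc (Suc i) \<in> a \<longleftrightarrow> Suc (Suc i) \<in> b) \<and> agree_off i a b)"
  unfolding tangle_mat_E[OF assms]
  by (subst split_three[where i = i]) (auto simp: agree_off_def)

lemma tangle_mat_E_snd:
  assumes "Suc i < n" "a \<subseteq> {1..n}" "b \<subseteq> {1..n}"
  shows "tangle_mat (tangle_E n (Suc i)) a b = of_bool ((Suc i \<in> a \<longleftrightarrow> Suc (Suc i) \<in> a) \<and>
    (Suc i \<in> b \<longleftrightarrow> Suc (Suc i) \<in> b) \<and> (i \<in> a \<longleftrightarrow> i \<in> b) \<and> agree_off i a b)"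
proof -
  have i: "1 \<le> Suc i" by simp
  show ?thesis unfolding tangle_mat_E[OF i assms]
    by (subst split_three[where i = i]) (auto simp: agree_off_def)
qed

text \<open>The product is computed as \<open>E_i (v_j E_i)\<close>, where the row sum of
  \<open>E_i\<close> has two terms; the hypothesis \<open>mat\<close> is what then remains. Moving
  the brackets keeps the count, since products with \<open>v_j\<close> create no closed
  curve.\<close>

lemma tangle_E_v_E_aux:
  assumes i: "1 \<le> i" "i < n" and j: "1 \<le> j" "j < n"
    and mat: "\<And>a c. a \<subseteq> {1..n} \<Longrightarrow> c \<subseteq> {1..n} \<Longrightarrow>
      of_bool (i \<in> a \<longleftrightarrow> i + 1 \<in> a) * (tangle_mat (tangle_E n i) (swap_adj j (a - {i, i + 1})) c +
        tangle_mat (tangle_E n i) (swap_adj j (a \<union> {i, i + 1})) c) = tangle_mat (tangle_E n i) a c"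
  shows "tangle_comp n (tangle_comp n (tangle_E n i) (tangle_v n j)) (tangle_E n i) = tangle_E n i \<and>
    closed_curves n (tangle_comp n (tangle_E n i) (tangle_v n j)) (tangle_E n i) = 0"
proof -
  note E = tangle_E_flat[OF i] and v = tangle_v_flat[OF j]
  have "tangle_comp n (tangle_E n i) (tangle_comp n (tangle_v n j) (tangle_E n i)) = tangle_E n i \<and>
    closed_curves n (tangle_E n i) (tangle_comp n (tangle_v n j) (tangle_E n i)) = 0"
  proof (rule tangle_comp_eqI[OF E tangle_comp_closed[OF v E] E])
    fix a c assume ac: "a \<subseteq> {1..n}" "c \<subseteq> {1..n}"
    have lu: "a - {i, i + 1} \<subseteq> {1..n}" "a \<union> {i, i + 1} \<subseteq> {1..n}" using ac i by auto
    show "(\<Sum>b\<in>Pow {1..n}. tangle_mat (tangle_E n i) a b *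
        tangle_mat (tangle_comp n (tangle_v n j) (tangle_E n i)) b c) =
        2 ^ 0 * tangle_mat (tangle_E n i) a c"
      unfolding sum_tangle_mat_E[OF i ac(1)] tangle_mat_v_comp[OF j E lu(1) ac(2)]
        tangle_mat_v_comp[OF j E lu(2) ac(2)] mat[OF ac] by simp
  qed
  then show ?thesis
    using tangle_comp_assoc[OF E v E] closed_curves_v_left[OF j E] closed_curves_v_right[OF j E] by simp
qed

text \<open>\<open>v_{i+1}\<close> moves the colour of strand \<open>i + 2\<close> next to strand
  \<open>i\<close>. That colour selects exactly one of the two middle colourings, so no factor 2
  arises.\<close>

lemma tangle_E_v_E_fst:
  assumes i: "1 \<le> i" "Suc i < n"
  shows "tangle_comp n (tangle_comp n (tangle_E n i) (tangle_v n (Suc i))) (tangle_E n i) = tangle_E n i \<and>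
    closed_curves n (tangle_comp n (tangle_E n i) (tangle_v n (Suc i))) (tangle_E n i) = 0"
proof (rule tangle_E_v_E_aux)
  fix a c assume ac: "a \<subseteq> {1..n}" "c \<subseteq> {1..n}"
  have i': "i < n" "1 \<le> Suc i" using i by auto
  have lu: "a - {i, i + 1} \<subseteq> {1..n}" "a \<union> {i, i + 1} \<subseteq> {1..n}" using ac i by auto
  note sw = lu[THEN swap_adj_subset[OF i'(2) i(2)]]
  show "of_bool (i \<in> a \<longleftrightarrow> i + 1 \<in> a) *
      (tangle_mat (tangle_E n i) (swap_adj (Suc i) (a - {i, i + 1})) c +
       tangle_mat (tangle_E n i) (swap_adj (Suc i) (a \<union> {i, i + 1})) c) = tangle_mat (tangle_E n i) a c"
    unfolding tangle_mat_E_fst[OF i(1) i'(1) ac] tangle_mat_E_fst[OF i(1) i'(1) sw(1) ac(2)]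
      tangle_mat_E_fst[OF i(1) i'(1) sw(2) ac(2)]
    by auto
qed (use i in auto)

text \<open>The mirror case: now the colour of strand \<open>i\<close> selects the middle
  colouring.\<close>

lemma tangle_E_v_E_snd:
  assumes i: "1 \<le> i" "Suc i < n"
  shows "tangle_comp n (tangle_comp n (tangle_E n (Suc i)) (tangle_v n i)) (tangle_E n (Suc i)) =
      tangle_E n (Suc i) \<and>
    closed_curves n (tangle_comp n (tangle_E n (Suc i)) (tangle_v n i)) (tangle_E n (Suc i)) = 0"
proof (rule tangle_E_v_E_aux)
  fix a c assume ac: "a \<subseteq> {1..n}" "c \<subseteq> {1..n}"
  have i': "i < n" using i by auto
  have lu: "a - {Suc i, Suc i + 1} \<subseteq> {1..n}" "a \<union> {Suc i, Suc i + 1} \<subseteq> {1..n}" using ac i by auto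
  note sw = lu[THEN swap_adj_subset[OF i(1) i']]
  show "of_bool (Suc i \<in> a \<longleftrightarrow> Suc i + 1 \<in> a) *
      (tangle_mat (tangle_E n (Suc i)) (swap_adj i (a - {Suc i, Suc i + 1})) c +
       tangle_mat (tangle_E n (Suc i)) (swap_adj i (a \<union> {Suc i, Suc i + 1})) c) =
      tangle_mat (tangle_E n (Suc i)) a c"
    unfolding tangle_mat_E_snd[OF i(2) ac] tangle_mat_E_snd[OF i(2) sw(1) ac(2)]
      tangle_mat_E_snd[OF i(2) sw(2) ac(2)]
    by auto
qed (use i in auto)

text \<open>Conjugation, as \<open>v_i\<close> is its own inverse; on matrices it permutes rows and
  columns by \<open>swap_adj i\<close>.\<close>

definition v_conj :: "nat \<Rightarrow> nat \<Rightarrow> tangle \<Rightarrow> tangle" where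
  "v_conj n i X = tangle_comp n (tangle_comp n (tangle_v n i) X) (tangle_v n i)"

lemma v_conj_flat:
  assumes "1 \<le> i" "i < n" "X \<in> flat_tangles n"
  shows "v_conj n i X \<in> flat_tangles n"
  using assms by (simp add: v_conj_def tangle_comp_closed tangle_v_flat)

lemma tangle_mat_v_conj:
  assumes i: "1 \<le> i" "i < n" and X: "X \<in> flat_tangles n" and ac: "a \<subseteq> {1..n}" "c \<subseteq> {1..n}"
  shows "tangle_mat (v_conj n i X) a c = tangle_mat X (swap_adj i a) (swap_adj i c)"
  unfolding v_conj_def tangle_mat_comp_v[OF i tangle_comp_closed[OF tangle_v_flat[OF i] X] ac]
  by (rule tangle_mat_v_comp[OF i X ac(1) swap_adj_subset[OF i ac(2)]])

section \<open>Conjugating the terms of \<open>S_i v_{i+1} S_i^{-1}\<close> by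
  \<open>v_{i+1} v_i\<close>\<close>

context
  fixes n i :: nat
  assumes i: "1 \<le> i" "Suc i < n"
begin

private lemma i': "i < n" "1 \<le> Suc i"
  using i by auto

private lemmas flat = tangle_v_flat[OF i(1) i'(1)] tangle_v_flat[OF i'(2) i(2)]
  tangle_E_flat[OF i(1) i'(1)] tangle_E_flat[OF i'(2) i(2)] tangle_comp_closed v_conj_flat

private lemmas mats = tangle_mat_v_conj[OF i(1) i'(1)] tangle_mat_v_conj[OF i'(2) i(2)]
  tangle_mat_v_comp[OF i(1) i'(1)] tangle_mat_v_comp[OF i'(2) i(2)]
  tangle_mat_comp_v[OF i(1) i'(1)] tangle_mat_comp_v[OF i'(2) i(2)]
  tangle_mat_v[OF i(1) i'(1)] tangle_mat_v[OF i'(2) i(2)]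
  tangle_mat_E_fst[OF i(1) i'(1)] tangle_mat_E_snd[OF i(2)]
  swap_adj_subset[OF i(1) i'(1)] swap_adj_subset[OF i'(2) i(2)] set_eq_agree_off[where i = i]

text \<open>The braid relation \<open>v_{i+1} v_i v_{i+1} = v_i v_{i+1} v_i\<close> in conjugated
  form.\<close>

lemma v_conj_v: "v_conj n (Suc i) (v_conj n i (tangle_v n (Suc i))) = tangle_v n i"
proof (rule tangle_mat_inject)
  fix a b assume "a \<subseteq> {1..n}" "b \<subseteq> {1..n}"
  then show "tangle_mat (v_conj n (Suc i) (v_conj n i (tangle_v n (Suc i)))) a b =
      tangle_mat (tangle_v n i) a b"
    using i i' by (simp add: mats flat del: One_nat_def)
qed (use i i' in \<open>auto intro!: flat\<close>)

text \<open>The order of the factors changes because the conjugates of \<open>E_i\<close> and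
  \<open>v_{i+1}\<close> are \<open>v_i E_{i+1} v_i\<close> and \<open>v_i\<close>, and the adjacent
  copies of \<open>v_i\<close> cancel.\<close>

lemma v_conj_E_v:
  "v_conj n (Suc i) (v_conj n i (tangle_comp n (tangle_E n i) (tangle_v n (Suc i)))) =
    tangle_comp n (tangle_v n i) (tangle_E n (Suc i))"
proof (rule tangle_mat_inject)
  fix a b assume "a \<subseteq> {1..n}" "b \<subseteq> {1..n}"
  then show "tangle_mat (v_conj n (Suc i) (v_conj n i (tangle_comp n (tangle_E n i) (tangle_v n (Suc i))))) a b =
      tangle_mat (tangle_comp n (tangle_v n i) (tangle_E n (Suc i))) a b"
    using i i' by (simp add: mats flat del: One_nat_def)
qed (use i i' in \<open>auto intro!: flat\<close>)

lemma v_conj_v_E: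
  "v_conj n (Suc i) (v_conj n i (tangle_comp n (tangle_v n (Suc i)) (tangle_E n i))) =
    tangle_comp n (tangle_E n (Suc i)) (tangle_v n i)"
proof (rule tangle_mat_inject)
  fix a b assume "a \<subseteq> {1..n}" "b \<subseteq> {1..n}"
  then show "tangle_mat (v_conj n (Suc i) (v_conj n i (tangle_comp n (tangle_v n (Suc i)) (tangle_E n i)))) a b =
      tangle_mat (tangle_comp n (tangle_E n (Suc i)) (tangle_v n i)) a b"
    using i i' by (simp add: mats flat del: One_nat_def)
qed (use i i' in \<open>auto intro!: flat\<close>)

text \<open>On each level, both sides join strands \<open>i\<close> and \<open>i + 2\<close> by an
  arc.\<close>

lemma v_conj_E: "v_conj n (Suc i) (v_conj n i (tangle_E n i)) = v_conj n i (tangle_E n (Suc i))"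
proof (rule tangle_mat_inject)
  fix a b assume "a \<subseteq> {1..n}" "b \<subseteq> {1..n}"
  then show "tangle_mat (v_conj n (Suc i) (v_conj n i (tangle_E n i))) a b =
      tangle_mat (v_conj n i (tangle_E n (Suc i))) a b"
    using i i' by (simp add: mats flat del: One_nat_def)
qed (use i i' in \<open>auto intro!: flat\<close>)

end

lemma v_conj_id:
  assumes i: "1 \<le> i" "i < n" shows "v_conj n i (tangle_id n) = tangle_id n"
proof (rule tangle_mat_inject)
  fix a b assume ab: "a \<subseteq> {1..n}" "b \<subseteq> {1..n}"
  note sw = ab[THEN swap_adj_subset[OF i]]
  show "tangle_mat (v_conj n i (tangle_id n)) a b = tangle_mat (tangle_id n) a b"
    unfolding tangle_mat_v_conj[OF i tangle_id_flat ab] tangle_mat_id[OF sw] tangle_mat_id[OF ab]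
    by (rule arg_cong[where f = of_bool]) (metis swap_adj_swap_adj)
qed (use tangle_id_flat v_conj_flat[OF i] in auto)

section \<open>Adding a strand: products and closures\<close>

lemma tangle_incl_comp:
  assumes E: "E \<in> flat_tangles n" and F: "F \<in> flat_tangles n"
  shows "tangle_comp (n + 1) (tangle_incl n E) (tangle_incl n F) = tangle_incl n (tangle_comp n E F) \<and>
    closed_curves (n + 1) (tangle_incl n E) (tangle_incl n F) = closed_curves n E F"
proof (rule tangle_comp_eqI[OF tangle_incl_flat[OF E] tangle_incl_flat[OF F]
      tangle_incl_flat[OF tangle_comp_closed[OF E F]]])
  fix a c assume "a \<subseteq> {1..n + 1}" "c \<subseteq> {1..n + 1}"
  then have ac: "a - {n + 1} \<subseteq> {1..n}" "c - {n + 1} \<subseteq> {1..n}" by auto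
  \<comment> \<open>Of the two colours of the middle point \<open>n + 1\<close> only the one
    agreeing with \<open>a\<close> can contribute, and it must agree with \<open>c\<close> as
    well.\<close>
  have "(\<Sum>b\<in>Pow {1..n + 1}. tangle_mat (tangle_incl n E) a b * tangle_mat (tangle_incl n F) b c) =
     (\<Sum>b\<in>Pow {1..n}. tangle_mat E (a - {n + 1}) b * tangle_mat F b (c - {n + 1})) *
       of_bool (n + 1 \<in> a \<longleftrightarrow> n + 1 \<in> c)"
    unfolding sum_Pow_Suc sum_distrib_right
  proof (rule sum.cong[OF refl])
    fix b assume "b \<in> Pow {1..n}"
    then have "b - {n + 1} = b" "insert (n + 1) b - {n + 1} = b" "n + 1 \<notin> b" by auto
    then show "tangle_mat (tangle_incl n E) a b * tangle_mat (tangle_incl n F) b c +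
        tangle_mat (tangle_incl n E) a (insert (n + 1) b) *
        tangle_mat (tangle_incl n F) (insert (n + 1) b) c =
        tangle_mat E (a - {n + 1}) b * tangle_mat F b (c - {n + 1}) *
        of_bool (n + 1 \<in> a \<longleftrightarrow> n + 1 \<in> c)"
      unfolding tangle_mat_incl[OF E] tangle_mat_incl[OF F] by auto
  qed
  then show "(\<Sum>b\<in>Pow {1..n + 1}. tangle_mat (tangle_incl n E) a b * tangle_mat (tangle_incl n F) b c) =
      2 ^ closed_curves n E F * tangle_mat (tangle_incl n (tangle_comp n E F)) a c"
    unfolding tangle_mat_comp[OF E F ac] tangle_mat_incl[OF tangle_comp_closed[OF E F]]
    by (simp only: mult.assoc)
qed

text \<open>The added strand closes up to a separate circle, so the matrix trace doubles.\<close>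

lemma closure_curves_incl:
  assumes E: "E \<in> flat_tangles n"
  shows "closure_curves (n + 1) (tangle_incl n E) = closure_curves n E + 1"
proof -
  have "(\<Sum>a\<in>Pow {1..n + 1}. tangle_mat (tangle_incl n E) a a) = (\<Sum>a\<in>Pow {1..n}. 2 * tangle_mat E a a)"
    unfolding sum_Pow_Suc
  proof (rule sum.cong[OF refl])
    fix a assume "a \<in> Pow {1..n}"
    then have "a - {n + 1} = a" "insert (n + 1) a - {n + 1} = a" by auto
    then show "tangle_mat (tangle_incl n E) a a +
        tangle_mat (tangle_incl n E) (insert (n + 1) a) (insert (n + 1) a) = 2 * tangle_mat E a a"
      unfolding tangle_mat_incl[OF E] by simp
  qed
  then have "(2::nat) ^ closure_curves (n + 1) (tangle_incl n E) = 2 ^ (closure_curves n E + 1)"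
    unfolding tangle_mat_trace[OF tangle_incl_flat[OF E]] power_add
      tangle_mat_trace[OF E, symmetric] by (simp add: sum_distrib_left mult.commute)
  then show ?thesis by (simp only: power_inject_exp one_less_numeral_iff semiring_norm)
qed

text \<open>The colour at \<open>n + 1\<close> is forced to be the one at \<open>n\<close>, so each
  diagonal entry of the matrix of \<open>E\<close> is counted exactly once.\<close>

lemma closure_curves_incl_E:
  assumes n: "1 \<le> n" and E: "E \<in> flat_tangles n"
  shows "closed_curves (n + 1) (tangle_incl n E) (tangle_E (n + 1) n) +
    closure_curves (n + 1) (tangle_comp (n + 1) (tangle_incl n E) (tangle_E (n + 1) n)) =
    closure_curves n E"
proof -
  let ?M = "tangle_mat (tangle_incl n E)" and ?N = "tangle_mat (tangle_E (n + 1) n)"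
  have n': "1 \<le> n" "n < n + 1" using n by auto
  have "(\<Sum>a\<in>Pow {1..n + 1}. \<Sum>b\<in>Pow {1..n + 1}. ?M a b * ?N b a) =
      (\<Sum>b\<in>Pow {1..n + 1}. \<Sum>a\<in>Pow {1..n + 1}. ?N b a * ?M a b)"
    by (subst sum.swap) (simp only: mult.commute)
  also have "\<dots> = (\<Sum>b\<in>Pow {1..n + 1}. of_bool (n \<in> b \<longleftrightarrow> n + 1 \<in> b) *
      (?M (b - {n, n + 1}) b + ?M (b \<union> {n, n + 1}) b))"
    by (rule sum.cong[OF refl], rule sum_tangle_mat_E[OF n']) simp
  also have "\<dots> = (\<Sum>b\<in>Pow {1..n}. tangle_mat E b b)"
    unfolding sum_Pow_Suc
  proof (rule sum.cong[OF refl])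
    fix b assume "b \<in> Pow {1..n}"
    then have b: "n + 1 \<notin> b" by auto
    have "b - {n, n + 1} - {n + 1} = b" if "n \<notin> b" using b that by auto
    moreover have "insert (n + 1) b \<union> {n, n + 1} - {n + 1} = b" if "n \<in> b" using b that by auto
    moreover have "b - {n + 1} = b" "insert (n + 1) b - {n + 1} = b" using b by auto
    ultimately show "of_bool (n \<in> b \<longleftrightarrow> n + 1 \<in> b) * (?M (b - {n, n + 1}) b + ?M (b \<union> {n, n + 1}) b) +
        of_bool (n \<in> insert (n + 1) b \<longleftrightarrow> n + 1 \<in> insert (n + 1) b) *
        (?M (insert (n + 1) b - {n, n + 1}) (insert (n + 1) b) +
         ?M (insert (n + 1) b \<union> {n, n + 1}) (insert (n + 1) b)) = tangle_mat E b b"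
      using b unfolding tangle_mat_incl[OF E] by (cases "n \<in> b") simp_all
  qed
  finally have "(2::nat) ^ (closed_curves (n + 1) (tangle_incl n E) (tangle_E (n + 1) n) +
    closure_curves (n + 1) (tangle_comp (n + 1) (tangle_incl n E) (tangle_E (n + 1) n))) =
    2 ^ closure_curves n E"
    unfolding closure_curves_comp[OF tangle_incl_flat[OF E] tangle_E_flat[OF n']] tangle_mat_trace[OF E] .
  then show ?thesis by (simp only: power_inject_exp one_less_numeral_iff semiring_norm)
qed

text \<open>An entry survives only if \<open>n\<close> and \<open>n + 1\<close> have equal colours,
  and then \<open>swap_adj n\<close> fixes the colouring; again each diagonal entry is counted
  once.\<close>

lemma closure_curves_incl_v:
  assumes n: "1 \<le> n" and E: "E \<in> flat_tangles n"
  shows "closure_curves (n + 1) (tangle_comp (n + 1) (tangle_incl n E) (tangle_v (n + 1) n)) =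
    closure_curves n E"
proof -
  let ?M = "tangle_mat (tangle_incl n E)"
  have n': "1 \<le> n" "n < n + 1" using n by auto
  note incl = tangle_incl_flat[OF E]
  have "(\<Sum>a\<in>Pow {1..n + 1}. tangle_mat (tangle_comp (n + 1) (tangle_incl n E) (tangle_v (n + 1) n)) a a) =
      (\<Sum>a\<in>Pow {1..n + 1}. ?M a (swap_adj n a))"
    by (rule sum.cong[OF refl], rule tangle_mat_comp_v[OF n' incl]) auto
  also have "\<dots> = (\<Sum>a\<in>Pow {1..n}. tangle_mat E a a)"
    unfolding sum_Pow_Suc
  proof (rule sum.cong[OF refl])
    fix a assume "a \<in> Pow {1..n}"
    then have a: "n + 1 \<notin> a" by auto
    have "swap_adj n a = a" if "n \<notin> a" using a that by (auto simp: swap_adj_def)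
    moreover have "swap_adj n (insert (n + 1) a) = insert (n + 1) a" if "n \<in> a"
      using a that by (auto simp: swap_adj_def)
    moreover have "n + 1 \<in> swap_adj n b \<longleftrightarrow> n \<in> b" for b by (auto simp: swap_adj_def)
    moreover have "a - {n + 1} = a" "insert (n + 1) a - {n + 1} = a" using a by auto
    ultimately show "?M a (swap_adj n a) + ?M (insert (n + 1) a) (swap_adj n (insert (n + 1) a)) =
        tangle_mat E a a"
      using a unfolding tangle_mat_incl[OF E] by (cases "n \<in> a") simp_all
  qed
  finally have "(2::nat) ^ closure_curves (n + 1) (tangle_comp (n + 1) (tangle_incl n E) (tangle_v (n + 1) n)) =
    2 ^ closure_curves n E"
    unfolding tangle_mat_trace[OF E] tangle_mat_trace[OF tangle_comp_closed[OF incl tangle_v_flat[OF n']]] .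
  then show ?thesis by (simp only: power_inject_exp one_less_numeral_iff semiring_norm)
qed

section \<open>The algebra and its trace\<close>

abbreviation basis :: "tangle \<Rightarrow> (tangle \<Rightarrow>\<^sub>0 laurent)" where
  "basis E \<equiv> Poly_Mapping.single E 1"

abbreviation vmult :: "nat \<Rightarrow> (tangle \<Rightarrow>\<^sub>0 laurent) \<Rightarrow> (tangle \<Rightarrow>\<^sub>0 laurent) \<Rightarrow> (tangle \<Rightarrow>\<^sub>0 laurent)" where
  "vmult n \<equiv> vtl_mult z_laurent n"

lemma VTL_R_simps [simp]:
  "carrier (VTL_R n) = {x. Poly_Mapping.keys x \<subseteq> flat_tangles n}"
  "x \<otimes>\<^bsub>VTL_R n\<^esub> y = vmult n x y" "\<one>\<^bsub>VTL_R n\<^esub> = basis (tangle_id n)"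
  "x \<oplus>\<^bsub>VTL_R n\<^esub> y = x + y" "c \<odot>\<^bsub>VTL_R n\<^esub> x = Poly_Mapping.map ((*) c) x"
  by (simp_all add: VTL_R_def VTL_alg_def)

lemma carrier_single:
  "E \<in> flat_tangles n \<Longrightarrow> Poly_Mapping.single E c \<in> carrier (VTL_R n)" for c :: laurent
  by simp

lemma carrier_add:
  "x \<in> carrier (VTL_R n) \<Longrightarrow> y \<in> carrier (VTL_R n) \<Longrightarrow> x + y \<in> carrier (VTL_R n)"
  using Poly_Mapping.keys_add[of x y] by auto

text \<open>Elements are finite sums of scaled basis tangles, so an identity additive in an argument
  need only be checked on a single tangle with a coefficient.\<close>

lemma carrier_induct [consumes 1, case_names zero single add]:
  assumes x: "x \<in> carrier (VTL_R n)"
    and zero: "P 0"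
    and single: "\<And>E c. E \<in> flat_tangles n \<Longrightarrow> P (Poly_Mapping.single E c)"
    and add: "\<And>x y. P x \<Longrightarrow> P y \<Longrightarrow> P (x + y)"
  shows "P x"
proof -
  have sum: "P (\<Sum>E\<in>A. Poly_Mapping.single E (Poly_Mapping.lookup x E))"
    if "finite A" "A \<subseteq> flat_tangles n" for A
    using that by (induction A rule: finite_induct) (auto intro: zero single add)
  have "(\<Sum>E\<in>Poly_Mapping.keys x. Poly_Mapping.single E (Poly_Mapping.lookup x E)) = x"
    by (rule poly_mapping_eqI) (simp add: lookup_sum lookup_single when_def in_keys_iff)
  then show ?thesis using sum[of "Poly_Mapping.keys x"] x by simp
qed

section \<open>Bilinearity of the multiplication\<close>

lemma map_times_zero: "Poly_Mapping.map ((*) c) 0 = 0"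
  for c :: laurent
  by (rule poly_mapping_eqI) (simp add: Poly_Mapping.map.rep_eq when_def)

lemma map_times_single: "Poly_Mapping.map ((*) c) (Poly_Mapping.single E d) = Poly_Mapping.single E (c * d)"
  for c :: laurent
  by (rule poly_mapping_eqI) (simp add: Poly_Mapping.map.rep_eq lookup_single when_def)

lemma map_times_add: "Poly_Mapping.map ((*) c) (x + y) = Poly_Mapping.map ((*) c) x + Poly_Mapping.map ((*) c) y"
  for c :: laurent
  by (rule poly_mapping_eqI) (auto simp: Poly_Mapping.map.rep_eq lookup_add when_def simp flip: distrib_left)

text \<open>Cancellation may make the keys of a sum smaller than the union of the keys. Summing over
  a common finite superset reduces bilinearity to distributing sums.\<close>

lemma vtl_mult_superset:
  assumes "finite A" "finite B" "Poly_Mapping.keys x \<subseteq> A" "Poly_Mapping.keys y \<subseteq> B"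
  shows "vtl_mult \<delta> n x y = (\<Sum>E\<in>A. \<Sum>F\<in>B. Poly_Mapping.single (tangle_comp n E F)
    (Poly_Mapping.lookup x E * Poly_Mapping.lookup y F * \<delta> ^ closed_curves n E F))"
proof -
  have "vtl_mult \<delta> n x y = (\<Sum>E\<in>A. \<Sum>F\<in>Poly_Mapping.keys y. Poly_Mapping.single (tangle_comp n E F)
      (Poly_Mapping.lookup x E * Poly_Mapping.lookup y F * \<delta> ^ closed_curves n E F))"
    unfolding vtl_mult_def
    by (rule sum.mono_neutral_left) (use assms in \<open>auto simp: in_keys_iff\<close>)
  also have "\<dots> = (\<Sum>E\<in>A. \<Sum>F\<in>B. Poly_Mapping.single (tangle_comp n E F)
      (Poly_Mapping.lookup x E * Poly_Mapping.lookup y F * \<delta> ^ closed_curves n E F))"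
    by (intro sum.cong refl sum.mono_neutral_left) (use assms in \<open>auto simp: in_keys_iff\<close>)
  finally show ?thesis .
qed

lemma vtl_mult_zero [simp]: "vtl_mult \<delta> n 0 y = 0" "vtl_mult \<delta> n x 0 = 0"
  by (simp_all add: vtl_mult_def)

lemma vtl_mult_single:
  "vtl_mult \<delta> n (Poly_Mapping.single E c) (Poly_Mapping.single F d) =
    Poly_Mapping.single (tangle_comp n E F) (c * d * \<delta> ^ closed_curves n E F)"
  by (subst vtl_mult_superset[of "{E}" "{F}"]) auto

lemma vtl_mult_add_left: "vtl_mult \<delta> n (x + y) w = vtl_mult \<delta> n x w + vtl_mult \<delta> n y w"
proof -
  let ?A = "Poly_Mapping.keys x \<union> Poly_Mapping.keys y" and ?B = "Poly_Mapping.keys w"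
  have "Poly_Mapping.keys (x + y) \<subseteq> ?A" by (rule Poly_Mapping.keys_add)
  then show ?thesis
    by (subst (1 2 3) vtl_mult_superset[of ?A ?B])
      (auto simp: lookup_add distrib_right single_add sum.distrib)
qed

lemma vtl_mult_add_right: "vtl_mult \<delta> n w (x + y) = vtl_mult \<delta> n w x + vtl_mult \<delta> n w y"
proof -
  let ?A = "Poly_Mapping.keys x \<union> Poly_Mapping.keys y" and ?B = "Poly_Mapping.keys w"
  have "Poly_Mapping.keys (x + y) \<subseteq> ?A" by (rule Poly_Mapping.keys_add)
  then show ?thesis
    by (subst (1 2 3) vtl_mult_superset[of ?B ?A])
      (auto simp: lookup_add distrib_right distrib_left single_add sum.distrib)
qed

section \<open>Closure, associativity and unit\<close>

lemma vmult_carrier: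
  assumes "x \<in> carrier (VTL_R n)" "y \<in> carrier (VTL_R n)"
  shows "vmult n x y \<in> carrier (VTL_R n)"
  using assms(1)
proof (induction x rule: carrier_induct)
  case (single E c)
  from assms(2) single show ?case
    by (induction y rule: carrier_induct)
      (auto simp: vtl_mult_single vtl_mult_add_right tangle_comp_closed simp del: VTL_R_simps(1)
        intro!: carrier_single carrier_add, simp)
next
  case (add x y)
  then show ?case by (simp only: vtl_mult_add_left carrier_add)
qed simp

text \<open>Additivity in each argument reduces this to tangles, where
  \<open>tangle_comp_assoc\<close> supplies equal composites and equal exponents. The colour count 2
  served to compare exponents; the powers here are powers of \<open>z_laurent\<close>.\<close>

lemma vmult_assoc:
  assumes x: "x \<in> carrier (VTL_R n)" and y: "y \<in> carrier (VTL_R n)" and w: "w \<in> carrier (VTL_R n)"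
  shows "vmult n (vmult n x y) w = vmult n x (vmult n y w)"
  using x
proof (induction x rule: carrier_induct)
  case (single E c)
  show ?case using y
  proof (induction y rule: carrier_induct)
    case (single F d)
    show ?case using w
    proof (induction w rule: carrier_induct)
      case G: (single G e)
      note assoc = tangle_comp_assoc[OF \<open>E \<in> flat_tangles n\<close> \<open>F \<in> flat_tangles n\<close> G]
      have "z_laurent ^ closed_curves n E F * z_laurent ^ closed_curves n (tangle_comp n E F) G =
          z_laurent ^ closed_curves n F G * z_laurent ^ closed_curves n E (tangle_comp n F G)"
        unfolding power_add[symmetric] using assoc by simp
      then show ?case
        by (simp add: vtl_mult_single assoc mult.assoc mult.left_commute mult.commute[of _ e])
    qed (simp_all only: vtl_mult_zero vtl_mult_add_right)
  qed (simp_all only: vtl_mult_zero vtl_mult_add_right vtl_mult_add_left)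
qed (simp_all only: vtl_mult_zero vtl_mult_add_left)

lemma vmult_id_left:
  assumes "x \<in> carrier (VTL_R n)"
  shows "vmult n (basis (tangle_id n)) x = x"
  using assms by (induction x rule: carrier_induct)
    (simp_all add: vtl_mult_single vtl_mult_add_right tangle_comp_id_left)

lemma vmult_id_right:
  assumes "x \<in> carrier (VTL_R n)"
  shows "vmult n x (basis (tangle_id n)) = x"
  using assms by (induction x rule: carrier_induct)
    (simp_all add: vtl_mult_single vtl_mult_add_left tangle_comp_id_right)

section \<open>The trace form\<close>

lemma trace_f_zero [simp]: "trace_f n 0 = 0"
  by (simp add: trace_f_def)

lemma trace_f_single: "trace_f n (Poly_Mapping.single E c) = c * z_laurent ^ closure_curves n E"
  by (simp add: trace_f_def)

lemma trace_f_superset: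
  assumes "finite A" "Poly_Mapping.keys x \<subseteq> A"
  shows "trace_f n x = (\<Sum>E\<in>A. Poly_Mapping.lookup x E * z_laurent ^ closure_curves n E)"
  unfolding trace_f_def by (rule sum.mono_neutral_left) (use assms in \<open>auto simp: in_keys_iff\<close>)

lemma trace_f_add: "trace_f n (x + y) = trace_f n x + trace_f n y"
proof -
  let ?A = "Poly_Mapping.keys x \<union> Poly_Mapping.keys y"
  have "Poly_Mapping.keys (x + y) \<subseteq> ?A" by (rule Poly_Mapping.keys_add)
  then show ?thesis
    by (subst (1 2 3) trace_f_superset[of ?A]) (auto simp: lookup_add distrib_right sum.distrib)
qed

lemma linear_form_trace_f: "linear_form n (trace_f n)"
proof -
  have "trace_f n (Poly_Mapping.map ((*) c) x) = c * trace_f n x" if "x \<in> carrier (VTL_R n)" for c x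
    using that by (induction x rule: carrier_induct)
      (simp_all add: map_times_zero map_times_single map_times_add trace_f_single trace_f_add
        distrib_left mult.assoc)
  then show ?thesis unfolding linear_form_def by (simp add: trace_f_add)
qed

lemma trace_f_vmult_commute:
  assumes x: "x \<in> carrier (VTL_R n)" and y: "y \<in> carrier (VTL_R n)"
  shows "trace_f n (vmult n x y) = trace_f n (vmult n y x)"
  using x
proof (induction x rule: carrier_induct)
  case (single E c)
  show ?case using y
  proof (induction y rule: carrier_induct)
    case F: (single F d)
    have "z_laurent ^ closed_curves n E F * z_laurent ^ closure_curves n (tangle_comp n E F) =
        z_laurent ^ closed_curves n F E * z_laurent ^ closure_curves n (tangle_comp n F E)"
      unfolding power_add[symmetric] using closure_curves_comp_commute[OF single F] by simp
    then show ?case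
      by (simp add: vtl_mult_single trace_f_single mult.assoc mult.left_commute[of c])
  qed (simp_all add: vtl_mult_add_right vtl_mult_add_left trace_f_add)
qed (simp_all add: vtl_mult_add_right vtl_mult_add_left trace_f_add)

lemma trace_f_vmult_scale:
  assumes "x \<in> carrier (VTL_R n)"
  shows "trace_f n (vmult n x (Poly_Mapping.single F c)) = c * trace_f n (vmult n x (basis F))"
  using assms by (induction x rule: carrier_induct)
    (simp_all add: vtl_mult_single vtl_mult_add_left trace_f_single trace_f_add algebra_simps)

section \<open>The inclusion and its effect on the trace\<close>

lemma VTL_incl_zero [simp]: "VTL_incl n 0 = 0"
  by (simp add: VTL_incl_def)

lemma VTL_incl_single: "VTL_incl n (Poly_Mapping.single E c) = Poly_Mapping.single (tangle_incl n E) c"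
  by (simp add: VTL_incl_def tangle_incl_def)

lemma VTL_incl_superset:
  assumes "finite A" "Poly_Mapping.keys x \<subseteq> A"
  shows "VTL_incl n x = (\<Sum>E\<in>A. Poly_Mapping.single (tangle_incl n E) (Poly_Mapping.lookup x E))"
  unfolding VTL_incl_def tangle_incl_def
  by (rule sum.mono_neutral_left) (use assms in \<open>auto simp: in_keys_iff\<close>)

lemma VTL_incl_add: "VTL_incl n (x + y) = VTL_incl n x + VTL_incl n y"
proof -
  let ?A = "Poly_Mapping.keys x \<union> Poly_Mapping.keys y"
  have "Poly_Mapping.keys (x + y) \<subseteq> ?A" by (rule Poly_Mapping.keys_add)
  then show ?thesis
    by (subst (1 2 3) VTL_incl_superset[of ?A]) (auto simp: lookup_add single_add sum.distrib)
qed

lemma VTL_incl_carrier: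
  assumes "x \<in> carrier (VTL_R n)"
  shows "VTL_incl n x \<in> carrier (VTL_R (n + 1))"
  using assms
proof (induction x rule: carrier_induct)
  case (single E c)
  then show ?case unfolding VTL_incl_single by (intro carrier_single tangle_incl_flat)
next
  case (add x y)
  then show ?case unfolding VTL_incl_add by (rule carrier_add)
qed simp

lemma VTL_incl_vmult:
  assumes x: "x \<in> carrier (VTL_R n)" and y: "y \<in> carrier (VTL_R n)"
  shows "VTL_incl n (vmult n x y) = vmult (n + 1) (VTL_incl n x) (VTL_incl n y)"
  using x
proof (induction x rule: carrier_induct)
  case (single E c)
  show ?case using y
  proof (induction y rule: carrier_induct)
    case F: (single F d)
    show ?case using tangle_incl_comp[OF single F] by (simp add: vtl_mult_single VTL_incl_single)
  qed (simp_all add: vtl_mult_add_right VTL_incl_add)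
qed (simp_all add: vtl_mult_add_left VTL_incl_add)

lemma trace_f_incl:
  assumes "x \<in> carrier (VTL_R n)"
  shows "trace_f (n + 1) (VTL_incl n x) = z_laurent * trace_f n x"
  using assms
proof (induction x rule: carrier_induct)
  case (single E c)
  show ?case unfolding VTL_incl_single trace_f_single closure_curves_incl[OF single] by simp
qed (simp_all add: VTL_incl_add trace_f_add distrib_left)

lemma trace_f_incl_E:
  assumes "1 \<le> n" "x \<in> carrier (VTL_R n)"
  shows "trace_f (n + 1) (vmult (n + 1) (VTL_incl n x) (basis (tangle_E (n + 1) n))) = trace_f n x"
  using assms(2)
proof (induction x rule: carrier_induct)
  case (single E c)
  show ?case
    unfolding VTL_incl_single vtl_mult_single trace_f_single closure_curves_incl_E[OF assms(1) single, symmetric]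
    by (simp add: power_add mult.assoc)
qed (simp_all add: VTL_incl_add trace_f_add vtl_mult_add_left)

lemma trace_f_incl_v:
  assumes "1 \<le> n" "x \<in> carrier (VTL_R n)"
  shows "trace_f (n + 1) (vmult (n + 1) (VTL_incl n x) (basis (tangle_v (n + 1) n))) = trace_f n x"
  using assms(2)
proof (induction x rule: carrier_induct)
  case (single E c)
  show ?case
    unfolding VTL_incl_single vtl_mult_single trace_f_single closure_curves_incl_v[OF assms(1) single]
    using closed_curves_v_right[OF assms(1) _ tangle_incl_flat[OF single]] by simp
qed (simp_all add: VTL_incl_add trace_f_add vtl_mult_add_left)

section \<open>The elements \<open>S_i\<close> and their inverses\<close>

lemma Apow_mult: "Apow k * Apow l = Apow (k + l)"
  by (simp add: Apow_def mult_single)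

lemma Apow_zero: "Apow 0 = 1"
  by (simp add: Apow_def)

text \<open>The general element of the span of 1 and \<open>E_i\<close>, a commutative subalgebra
  that contains \<open>S_i\<close> and its inverse.\<close>

definition skein :: "nat \<Rightarrow> nat \<Rightarrow> laurent \<Rightarrow> laurent \<Rightarrow> (tangle \<Rightarrow>\<^sub>0 laurent)" where
  "skein n i c d = Poly_Mapping.single (tangle_id n) c + Poly_Mapping.single (tangle_E n i) d"

lemma S_gen_eq: "S_gen n i = skein n i (- Apow (-2)) (- Apow (-4))"
  by (simp add: S_gen_def E_gen_def skein_def map_times_single)

lemma skein_carrier: "1 \<le> i \<Longrightarrow> i < n \<Longrightarrow> skein n i c d \<in> carrier (VTL_R n)"
  unfolding skein_def by (intro carrier_add carrier_single tangle_id_flat tangle_E_flat)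

lemma skein_mult:
  assumes "1 \<le> i" "i < n"
  shows "vmult n (skein n i c d) (skein n i c' d') =
    skein n i (c * c') (c * d' + d * c' + d * d' * z_laurent)"
  using tangle_comp_id_left[OF tangle_E_flat[OF assms]] tangle_comp_id_right[OF tangle_E_flat[OF assms]]
    tangle_comp_id_left[OF tangle_id_flat] tangle_comp_E_E[OF assms]
  by (simp add: skein_def vtl_mult_add_left vtl_mult_add_right vtl_mult_single single_add add.assoc)

text \<open>In both products the coefficient of \<open>E_i\<close> is
  \<open>A^2 + A^{-2} + z\<close>, which vanishes.\<close>

lemma S_gen_inv:
  assumes i: "1 \<le> i" "i < n"
  shows "inv\<^bsub>VTL_R n\<^esub> S_gen n i = skein n i (- Apow 2) (- Apow 4)"
proof -
  let ?S = "S_gen n i" and ?T = "skein n i (- Apow 2) (- Apow 4)"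
  have carr: "?S \<in> carrier (VTL_R n)" "?T \<in> carrier (VTL_R n)"
    unfolding S_gen_eq by (rule skein_carrier[OF i])+
  have inv: "vmult n ?S ?T = basis (tangle_id n)" "vmult n ?T ?S = basis (tangle_id n)"
    unfolding S_gen_eq skein_mult[OF i]
    by (simp_all add: skein_def Apow_mult Apow_zero z_laurent_def right_diff_distrib)
  \<comment> \<open>\<open>inv\<close> is a definite description, so uniqueness is required:
    \<open>y = y (S T) = (y S) T = T\<close>.\<close>
  have "y = ?T" if y: "y \<in> carrier (VTL_R n)" "vmult n y ?S = basis (tangle_id n)" for y
    using vmult_assoc[OF y(1) carr] inv(1) y(2) vmult_id_right[OF y(1)] vmult_id_left[OF carr(2)]
    by simp
  then show ?thesis
    unfolding m_inv_def VTL_R_simps(2,3) using carr inv by (intro the_equality) blast+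
qed

text \<open>The unit contributes a free circle with value \<open>z\<close>, and \<open>E_n\<close>
  contributes 1. The condition on \<open>c\<close> and \<open>d\<close> holds for
  \<open>S_n\<close>, as \<open>-A^{-2} z - A^{-4} = 1\<close>, and for its inverse, as
  \<open>-A^2 z - A^4 = 1\<close>.\<close>

lemma trace_f_incl_skein:
  assumes n: "1 \<le> n" and x: "x \<in> carrier (VTL_R n)" and cd: "c * z_laurent + d = 1"
  shows "trace_f (n + 1) (vmult (n + 1) (VTL_incl n x) (skein (n + 1) n c d)) = trace_f n x"
proof -
  note X = VTL_incl_carrier[OF x]
  have "trace_f (n + 1) (vmult (n + 1) (VTL_incl n x) (skein (n + 1) n c d)) =
      (c * z_laurent + d) * trace_f n x"
    unfolding skein_def vtl_mult_add_right trace_f_add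
      trace_f_vmult_scale[OF X, of "tangle_id (n + 1)" c] trace_f_vmult_scale[OF X, of "tangle_E (n + 1) n" d]
      trace_f_incl_E[OF n x] vmult_id_right[OF X] trace_f_incl[OF x]
    by (simp add: algebra_simps)
  then show ?thesis using cd by simp
qed

text \<open>Expanding the brackets leaves \<open>v_j\<close>, \<open>v_j E_i\<close>,
  \<open>E_i v_j\<close> and \<open>E_i v_j E_i\<close>; the hypothesis \<open>EvE\<close> turns the
  last into \<open>E_i\<close> without a factor \<open>z\<close>.\<close>

lemma skein_v_skein:
  assumes i: "1 \<le> i" "i < n" and j: "1 \<le> j" "j < n"
    and EvE: "tangle_comp n (tangle_comp n (tangle_E n i) (tangle_v n j)) (tangle_E n i) = tangle_E n i \<and>
      closed_curves n (tangle_comp n (tangle_E n i) (tangle_v n j)) (tangle_E n i) = 0"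
  shows "vmult n (vmult n (skein n i c d) (basis (tangle_v n j))) (skein n i c' d') =
    Poly_Mapping.single (tangle_v n j) (c * c') +
    Poly_Mapping.single (tangle_comp n (tangle_v n j) (tangle_E n i)) (c * d') +
    Poly_Mapping.single (tangle_comp n (tangle_E n i) (tangle_v n j)) (d * c') +
    Poly_Mapping.single (tangle_E n i) (d * d')"
proof -
  note flat = tangle_E_flat[OF i] tangle_v_flat[OF j] tangle_comp_closed[OF tangle_E_flat[OF i] tangle_v_flat[OF j]]
  show ?thesis
    using EvE flat[THEN tangle_comp_id_left] flat[THEN tangle_comp_id_right]
      closed_curves_v_left[OF j flat(1)] closed_curves_v_right[OF j flat(1)]
    by (simp add: skein_def vtl_mult_add_left vtl_mult_add_right vtl_mult_single add_ac)
qed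

lemma vmult_v_conj:
  assumes i: "1 \<le> i" "i < n" and X: "X \<in> flat_tangles n"
  shows "vmult n (vmult n (basis (tangle_v n i)) (Poly_Mapping.single X c)) (basis (tangle_v n i)) =
    Poly_Mapping.single (v_conj n i X) c"
  using closed_curves_v_left[OF i X] closed_curves_v_right[OF i tangle_comp_closed[OF tangle_v_flat[OF i] X]]
  by (simp add: vtl_mult_single v_conj_def)

section \<open>The two stabilisation conditions with virtual crossings\<close>

context
  fixes n i :: nat and x :: "tangle \<Rightarrow>\<^sub>0 laurent"
  assumes n: "n = Suc i" and i: "1 \<le> i" and x: "x \<in> carrier (VTL_R n)"
begin

text \<open>Here \<open>i\<close> is \<open>n - 1\<close>. On \<open>n + 1\<close> strands,
  \<open>X\<close>, \<open>v\<close>, \<open>e\<close> stand for \<open>x\<close>,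
  \<open>v_{n-1}\<close>, \<open>E_n\<close>; on \<open>n\<close> strands, \<open>w\<close> stands
  for \<open>v_{n-1}\<close>. The multiples of \<open>q\<close> cancel in both expansions.\<close>

private definition "X = VTL_incl n x"
private definition "w = basis (tangle_v n i)"
private definition "v = basis (tangle_v (n + 1) i)"
private definition "e = basis (tangle_E (n + 1) n)"
private definition "q = trace_f n (vmult n x w)"

private lemma ineqs: "1 \<le> n" "i < n" "i < n + 1" "n < n + 1" "Suc i < n + 1"
  using n i by auto

private lemma w: "w \<in> carrier (VTL_R n)"
  unfolding w_def by (rule carrier_single[OF tangle_v_flat[OF i ineqs(2)]])

private lemma v_eq: "v = VTL_incl n w"
  by (simp only: v_def w_def VTL_incl_single tangle_incl_v[OF ineqs(2)])

private lemma carr: "X \<in> carrier (VTL_R (n + 1))" "v \<in> carrier (VTL_R (n + 1))" "e \<in> carrier (VTL_R (n + 1))"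
  unfolding X_def v_eq e_def
  by (intro VTL_incl_carrier x w carrier_single tangle_E_flat ineqs)+

text \<open>\<open>X v\<close> is an included element, so its last strand closes to a free
  circle.\<close>

private lemma trace_v: "trace_f (n + 1) (vmult (n + 1) X v) = z_laurent * q"
  unfolding X_def v_eq q_def VTL_incl_vmult[OF x w, symmetric] by (rule trace_f_incl[OF vmult_carrier[OF x w]])

private lemma trace_v_e: "trace_f (n + 1) (vmult (n + 1) X (vmult (n + 1) v e)) = q"
  unfolding vmult_assoc[OF carr, symmetric]
  unfolding X_def v_eq q_def e_def VTL_incl_vmult[OF x w, symmetric]
  by (rule trace_f_incl_E[OF ineqs(1) vmult_carrier[OF x w]])

text \<open>Cyclicity moves \<open>v\<close> in front of \<open>X\<close>, and \<open>v X\<close> is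
  again included; a second use of cyclicity on \<open>n\<close> strands gives
  \<open>q\<close>.\<close>

private lemma trace_e_v: "trace_f (n + 1) (vmult (n + 1) X (vmult (n + 1) e v)) = q"
proof -
  have "trace_f (n + 1) (vmult (n + 1) X (vmult (n + 1) e v)) =
      trace_f (n + 1) (vmult (n + 1) (vmult (n + 1) v X) e)"
    using trace_f_vmult_commute[OF vmult_carrier[OF carr(1,3)] carr(2)]
    unfolding vmult_assoc[OF carr(1,3,2)] vmult_assoc[OF carr(2,1,3)] .
  also have "\<dots> = trace_f n (vmult n w x)"
    unfolding X_def v_eq e_def VTL_incl_vmult[OF w x, symmetric]
    by (rule trace_f_incl_E[OF ineqs(1) vmult_carrier[OF w x]])
  finally show ?thesis unfolding q_def by (simp only: trace_f_vmult_commute[OF w x])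
qed

text \<open>Cyclicity turns the product into \<open>(v X v) e\<close> with \<open>v X v\<close>
  included, which leaves the trace of \<open>w x w\<close>; this is the trace of \<open>x\<close>
  because \<open>w\<close> is an involution.\<close>

private lemma trace_v_e_v:
  "trace_f (n + 1) (vmult (n + 1) X (vmult (n + 1) (vmult (n + 1) v e) v)) = trace_f n x"
proof -
  have ww: "vmult n w w = basis (tangle_id n)"
    using vmult_v_conj[OF i ineqs(2) tangle_id_flat, of 1] vmult_id_right[OF w]
    unfolding v_conj_id[OF i ineqs(2)] by (simp only: w_def)
  have "trace_f (n + 1) (vmult (n + 1) X (vmult (n + 1) (vmult (n + 1) v e) v)) =
      trace_f (n + 1) (vmult (n + 1) (vmult (n + 1) (vmult (n + 1) v X) v) e)"
    using trace_f_vmult_commute[OF vmult_carrier[OF carr(1) vmult_carrier[OF carr(2,3)]] carr(2)]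
    by (simp only: vmult_assoc vmult_carrier carr)
  also have "\<dots> = trace_f n (vmult n (vmult n w x) w)"
    unfolding X_def v_eq e_def VTL_incl_vmult[OF w x, symmetric]
      VTL_incl_vmult[OF vmult_carrier[OF w x] w, symmetric]
    by (rule trace_f_incl_E[OF ineqs(1) vmult_carrier[OF vmult_carrier[OF w x] w]])
  also have "\<dots> = trace_f n (vmult n (vmult n w w) x)"
    unfolding trace_f_vmult_commute[OF vmult_carrier[OF w x] w] vmult_assoc[OF w w x] ..
  finally show ?thesis unfolding ww vmult_id_left[OF x] .
qed

private lemma trace_sum:
  "trace_f (n + 1) (vmult (n + 1) X
    (Poly_Mapping.single F1 c1 + Poly_Mapping.single F2 c2 + Poly_Mapping.single F3 c3 +
     Poly_Mapping.single F4 c4)) =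
   c1 * trace_f (n + 1) (vmult (n + 1) X (basis F1)) + c2 * trace_f (n + 1) (vmult (n + 1) X (basis F2)) +
   c3 * trace_f (n + 1) (vmult (n + 1) X (basis F3)) + c4 * trace_f (n + 1) (vmult (n + 1) X (basis F4))"
  unfolding vtl_mult_add_right trace_f_add
  by (simp only: trace_f_vmult_scale[OF carr(1), of F1 c1] trace_f_vmult_scale[OF carr(1), of F2 c2]
      trace_f_vmult_scale[OF carr(1), of F3 c3] trace_f_vmult_scale[OF carr(1), of F4 c4])

private lemma basis_v_e: "basis (tangle_comp (n + 1) (tangle_v (n + 1) i) (tangle_E (n + 1) n)) = vmult (n + 1) v e"
  and basis_e_v: "basis (tangle_comp (n + 1) (tangle_E (n + 1) n) (tangle_v (n + 1) i)) = vmult (n + 1) e v"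
  and basis_v_e_v: "basis (v_conj (n + 1) i (tangle_E (n + 1) n)) = vmult (n + 1) (vmult (n + 1) v e) v"
  unfolding v_def e_def vmult_v_conj[OF i ineqs(3) tangle_E_flat[OF ineqs(1,4)]]
  by (simp_all only: vtl_mult_single closed_curves_v_left[OF i ineqs(3) tangle_E_flat[OF ineqs(1,4)]]
    closed_curves_v_right[OF i ineqs(3) tangle_E_flat[OF ineqs(1,4)]] power_0 mult_1_left)

lemma trace_f_right_virtual:
  "trace_f (n + 1) (vmult (n + 1) (vmult (n + 1) (vmult (n + 1) (VTL_incl n x)
      (inv\<^bsub>VTL_R (n + 1)\<^esub> S_gen (n + 1) n)) (basis (tangle_v (n + 1) i))) (S_gen (n + 1) n)) =
    trace_f n x"
proof -
  let ?m = "n + 1"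
  let ?S = "skein ?m n (- Apow (-2)) (- Apow (-4))" and ?T = "skein ?m n (- Apow 2) (- Apow 4)"
  note S = skein_carrier[OF ineqs(1,4)]
  have EvE: "tangle_comp ?m (tangle_comp ?m (tangle_E ?m n) (tangle_v ?m i)) (tangle_E ?m n) = tangle_E ?m n \<and>
      closed_curves ?m (tangle_comp ?m (tangle_E ?m n) (tangle_v ?m i)) (tangle_E ?m n) = 0"
    using tangle_E_v_E_snd[OF i ineqs(5)] by (simp only: n)
  have "trace_f ?m (vmult ?m (vmult ?m (vmult ?m X ?T) v) ?S) =
      trace_f ?m (vmult ?m X (vmult ?m (vmult ?m ?T v) ?S))"
    by (simp only: vmult_assoc vmult_carrier carr S)
  \<comment> \<open>The coefficients of \<open>v\<close>, \<open>v e\<close>, \<open>e v\<close>,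
    \<open>e\<close> in the expansion are 1, \<open>A^{-2}\<close>, \<open>A^2\<close>, 1.\<close>
  also have "\<dots> = z_laurent * q + Apow (-2) * q + Apow 2 * q + trace_f n x"
    unfolding skein_v_skein[OF ineqs(1,4) i ineqs(3) EvE, folded v_def] trace_sum basis_v_e basis_e_v
      trace_v_e trace_e_v trace_v[unfolded v_def] trace_f_incl_E[OF ineqs(1) x, folded X_def]
    by (simp add: Apow_mult Apow_zero)
  also have "\<dots> = trace_f n x" by (simp add: z_laurent_def algebra_simps)
  finally show ?thesis
    unfolding S_gen_inv[OF ineqs(1,4)] unfolding S_gen_eq X_def v_def .
qed

lemma trace_f_left_virtual:
  "trace_f (n + 1) (vmult (n + 1) (vmult (n + 1) (vmult (n + 1) (vmult (n + 1) (vmult (n + 1)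
      (vmult (n + 1) (vmult (n + 1) (VTL_incl n x) (basis (tangle_v (n + 1) n)))
        (basis (tangle_v (n + 1) i))) (S_gen (n + 1) i)) (basis (tangle_v (n + 1) n)))
      (inv\<^bsub>VTL_R (n + 1)\<^esub> S_gen (n + 1) i)) (basis (tangle_v (n + 1) i))) (basis (tangle_v (n + 1) n))) =
    trace_f n x"
proof -
  let ?m = "n + 1"
  let ?S = "skein ?m i (- Apow (-2)) (- Apow (-4))" and ?T = "skein ?m i (- Apow 2) (- Apow 4)"
  let ?u = "basis (tangle_v ?m n)"
  note S = skein_carrier[OF i ineqs(3)]
  have u: "?u \<in> carrier (VTL_R ?m)" by (rule carrier_single[OF tangle_v_flat[OF ineqs(1,4)]])
  note flat = tangle_v_flat[OF ineqs(1,4)] tangle_E_flat[OF i ineqs(3)]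
  note flats = flat tangle_comp_closed[OF flat] tangle_comp_closed[OF flat(2,1)]
  note conj = flats[THEN v_conj_flat[OF i ineqs(3)]]
  have EvE: "tangle_comp ?m (tangle_comp ?m (tangle_E ?m i) (tangle_v ?m n)) (tangle_E ?m i) = tangle_E ?m i \<and>
      closed_curves ?m (tangle_comp ?m (tangle_E ?m i) (tangle_v ?m n)) (tangle_E ?m i) = 0"
    using tangle_E_v_E_fst[OF i ineqs(5)] by (simp only: n)
  note conjs = v_conj_v[OF i ineqs(5), folded n] v_conj_E_v[OF i ineqs(5), folded n]
    v_conj_v_E[OF i ineqs(5), folded n] v_conj_E[OF i ineqs(5), folded n]
  \<comment> \<open>The middle factor \<open>S v_n S^{-1}\<close> has four terms by
    \<open>skein_v_skein\<close>. Conjugation by \<open>v_n v_{n-1}\<close> turns three of them into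
    terms of known traces \<open>z q\<close> and \<open>q\<close>, and \<open>E_{n-1}\<close> into
    \<open>v_{n-1} E_n v_{n-1}\<close>, which \<open>trace_v_e_v\<close> evaluates.\<close>
  have prod: "vmult ?m (vmult ?m ?u (vmult ?m (vmult ?m v (vmult ?m (vmult ?m ?S ?u) ?T)) v)) ?u =
      Poly_Mapping.single (tangle_v ?m i) 1 +
      Poly_Mapping.single (tangle_comp ?m (tangle_E ?m n) (tangle_v ?m i)) (Apow 2) +
      Poly_Mapping.single (tangle_comp ?m (tangle_v ?m i) (tangle_E ?m n)) (Apow (-2)) +
      Poly_Mapping.single (v_conj ?m i (tangle_E ?m n)) 1"
    unfolding skein_v_skein[OF i ineqs(3) ineqs(1,4) EvE] v_def
    by (simp only: vtl_mult_add_left vtl_mult_add_right vmult_v_conj[OF i ineqs(3)] flats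
        vmult_v_conj[OF ineqs(1,4)] conj conjs) (simp add: Apow_mult Apow_zero)
  have "trace_f ?m (vmult ?m (vmult ?m (vmult ?m (vmult ?m (vmult ?m
      (vmult ?m (vmult ?m X ?u) v) ?S) ?u) ?T) v) ?u) =
    trace_f ?m (vmult ?m X (vmult ?m (vmult ?m ?u (vmult ?m (vmult ?m v (vmult ?m (vmult ?m ?S ?u) ?T)) v)) ?u))"
    by (simp only: vmult_assoc vmult_carrier carr S u)
  also have "\<dots> = z_laurent * q + Apow 2 * q + Apow (-2) * q + trace_f n x"
    unfolding prod trace_sum
    unfolding basis_v_e basis_e_v basis_v_e_v trace_v_e trace_e_v trace_v_e_v
      trace_v[unfolded v_def] by simp
  also have "\<dots> = trace_f n x" by (simp add: z_laurent_def algebra_simps)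
  finally show ?thesis
    unfolding S_gen_inv[OF i ineqs(3)] unfolding S_gen_eq X_def v_def .
qed

end

section \<open>Verification of the Markov conditions\<close>

theorem theorem2p6:
  shows "markov_trace trace_f"
  unfolding markov_trace_def
proof (intro conjI allI impI ballI)
  fix n :: nat and x assume n: "n \<ge> 1" and x: "x \<in> carrier (VTL_R n)"
  have n': "n < n + 1" by simp
  show "trace_f n x = trace_f (n + 1) (VTL_incl n x \<otimes>\<^bsub>VTL_R (n + 1)\<^esub> S_gen (n + 1) n)"
    unfolding VTL_R_simps(2) S_gen_eq
    by (rule trace_f_incl_skein[OF n x, symmetric])
      (simp add: z_laurent_def right_diff_distrib Apow_mult Apow_zero)
  show "trace_f n x =
      trace_f (n + 1) (VTL_incl n x \<otimes>\<^bsub>VTL_R (n + 1)\<^esub> inv\<^bsub>VTL_R (n + 1)\<^esub> S_gen (n + 1) n)"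
    unfolding VTL_R_simps(2) S_gen_inv[OF n n']
    by (rule trace_f_incl_skein[OF n x, symmetric])
      (simp add: z_laurent_def right_diff_distrib Apow_mult Apow_zero)
  show "trace_f n x = trace_f (n + 1) (VTL_incl n x \<otimes>\<^bsub>VTL_R (n + 1)\<^esub> v_gen (n + 1) n)"
    unfolding VTL_R_simps(2) v_gen_def by (rule trace_f_incl_v[OF n x, symmetric])
next
  fix n :: nat and x assume n: "n \<ge> 2" and x: "x \<in> carrier (VTL_R n)"
  \<comment> \<open>The index \<open>n - 1\<close> is truncated subtraction; from
    \<open>n \<ge> 2\<close> it is a true predecessor and at least 1, as the index of a generator
    must be.\<close>
  then have i: "n = Suc (n - 1)" "1 \<le> n - 1" by auto
  show "trace_f n x = trace_f (n + 1) (VTL_incl n x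
      \<otimes>\<^bsub>VTL_R (n + 1)\<^esub> inv\<^bsub>VTL_R (n + 1)\<^esub> S_gen (n + 1) n
      \<otimes>\<^bsub>VTL_R (n + 1)\<^esub> v_gen (n + 1) (n - 1) \<otimes>\<^bsub>VTL_R (n + 1)\<^esub> S_gen (n + 1) n)"
    unfolding VTL_R_simps(2) v_gen_def by (rule trace_f_right_virtual[OF i x, symmetric])
  show "trace_f n x = trace_f (n + 1) (VTL_incl n x
      \<otimes>\<^bsub>VTL_R (n + 1)\<^esub> v_gen (n + 1) n \<otimes>\<^bsub>VTL_R (n + 1)\<^esub> v_gen (n + 1) (n - 1)
      \<otimes>\<^bsub>VTL_R (n + 1)\<^esub> S_gen (n + 1) (n - 1) \<otimes>\<^bsub>VTL_R (n + 1)\<^esub> v_gen (n + 1) n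
      \<otimes>\<^bsub>VTL_R (n + 1)\<^esub> inv\<^bsub>VTL_R (n + 1)\<^esub> S_gen (n + 1) (n - 1)
      \<otimes>\<^bsub>VTL_R (n + 1)\<^esub> v_gen (n + 1) (n - 1) \<otimes>\<^bsub>VTL_R (n + 1)\<^esub> v_gen (n + 1) n)"
    unfolding VTL_R_simps(2) v_gen_def by (rule trace_f_left_virtual[OF i x, symmetric])
qed (simp_all only: linear_form_trace_f VTL_R_simps(2) trace_f_vmult_commute)

end
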